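(* Let $N=n+k$ and fix $\lambda,\mu\subset(k^n)$ and $j\in\{1,\dots,N-1\}$. For each $\nu\subset(k^n)$ let $y_\nu=(y_i)_{i\in I_\nu}$ be the Bethe root described in the context, and set $[\mathcal{O}_\lambda]_\nu:=G_\lambda(y_\nu|\ominus t)$. Let $s_j$ act on formal power series in $q$ with coefficients rational in $\beta,t_1,\dots,t_N$ by interchanging $t_j$ and $t_{j+1}$. Then $$s_j\big(G_\lambda(y_{s_j\mu}|\ominus t)\big)-G_\lambda(y_\mu|\ominus t)=\begin{cases}(t_j\ominus t_{j+1})\big(\beta\,G_\lambda(y_\mu|\ominus t)+G_{s_j\lambda}(y_\mu|\ominus t)\big), & j\notin I_\lambda\text{ and } j+1\in I_\lambda,\\ 0,&\text{otherwise.}\end{cases}$$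
   Context: $\beta$ is an indeterminate, $x\oplus y=x+y+\beta xy$, $x\ominus y=(x-y)/(1+\beta y)$, $\ominus x=-x/(1+\beta x)$. A partition $\lambda\subset(k^n)$ (at most $n$ parts, each $\le k$) corresponds to the set $I_\lambda=\{\lambda_{n+1-i}+i: i=1,\dots,n\}\subset[N]$ and to the binary string $b(\lambda)\in\{0,1\}^N$ with $b_i=1$ iff $i\in I_\lambda$; $s_j\lambda$ denotes the partition whose binary string is obtained from $b(\lambda)$ by swapping its $j$-th and $(j+1)$-th letters. Factorial Grothendieck polynomial: for $x=(x_1,\dots,x_n)$ and a parameter sequence $s=(s_1,s_2,\dots)$, $G_\lambda(x|s)=\sum_T\beta^{|T|-|\lambda|}\prod_{(i,j)\in\lambda}\prod_{r\in T(i,j)}(x_r\oplus s_{r+j-i})$, summed over set-valued tableaux $T$ of shape $\lambda$ (assignments of nonempty subsets of $[n]$ to the boxes $(i,j)$ of $\lambda$, row $i$, column $j$, with $\max T(i,j)\le\min T(i,j+1)$ and $\max T(i,j)<\min T(i+1,j)$), $|T|$ the total number of entries. Here $\ominus t=(\ominus t_1,\ominus t_2,\dots)$ with $t_j=0$ for $j>N$. Bethe roots: with $\Pi(y)=\prod_i(1+\beta y_i)$, the Bethe ansatz equations for an $n$-tuple $y=(y_1,\dots,y_n)$ are $(-1)^n\frac{\Pi(y)}{(1+\beta y_i)^n}\prod_{j=1}^N (y_i\ominus t_j)+q=0$ for all $i$. For $\nu\subset(k^n)$, $y_\nu=(y_i)_{i\in I_\nu}$ denotes the solution of these equations in formal power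 series in $q$ (coefficients rational in $\beta,t$) with $y_i\equiv t_i \pmod q$ for $i\in I_\nu$ (there is exactly one such solution). Since $G_\lambda$ is symmetric in its variables the ordering of the components is immaterial. *)

theory Defs
  imports "HOL-Library.Poly_Mapping" "HOL-Computational_Algebra.Fraction_Field"
          "HOL-Computational_Algebra.Formal_Power_Series"
begin

text \<open>Polynomials over Q in the variables X_0, X_1, ... (X_0 = beta, X_i = t_i),
  and their field of fractions.\<close>
type_synonym rpoly = "(nat \<Rightarrow>\<^sub>0 nat) \<Rightarrow>\<^sub>0 rat"
type_synonym rf = "rpoly fract"

definition Xv :: "nat \<Rightarrow> rpoly" where
  "Xv v = Poly_Mapping.single (Poly_Mapping.single v 1) 1"

definition betaK :: rf where "betaK = Fraction_Field.Fract (Xv 0) 1"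

definition tK :: "nat \<Rightarrow> nat \<Rightarrow> rf" where
  "tK N m = (if 1 \<le> m \<and> m \<le> N then Fraction_Field.Fract (Xv m) 1 else 0)"

definition swapj :: "nat \<Rightarrow> nat \<Rightarrow> nat" where
  "swapj j i = (if i = j then Suc j else if i = Suc j then j else i)"

definition sigma_mon :: "nat \<Rightarrow> (nat \<Rightarrow>\<^sub>0 nat) \<Rightarrow> (nat \<Rightarrow>\<^sub>0 nat)" where
  "sigma_mon j m = Abs_poly_mapping (\<lambda>v. Poly_Mapping.lookup m (swapj j v))"

definition sigma_poly :: "nat \<Rightarrow> rpoly \<Rightarrow> rpoly" where
  "sigma_poly j p = Abs_poly_mapping (\<lambda>m. Poly_Mapping.lookup p (sigma_mon j m))"

definition sigmaK :: "nat \<Rightarrow> rf \<Rightarrow> rf" where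
  "sigmaK j x = (case (SOME (a, b). b \<noteq> 0 \<and> x = Fraction_Field.Fract a b) of
                   (a, b) \<Rightarrow> Fraction_Field.Fract (sigma_poly j a) (sigma_poly j b))"

definition sigmaF :: "nat \<Rightarrow> rf fps \<Rightarrow> rf fps" where
  "sigmaF j f = Abs_fps (\<lambda>d. sigmaK j (fps_nth f d))"

definition oplusB :: "'a::comm_ring_1 \<Rightarrow> 'a \<Rightarrow> 'a \<Rightarrow> 'a" where
  "oplusB b x y = x + y + b * x * y"

definition ominusB :: "'a::{comm_ring_1,inverse} \<Rightarrow> 'a \<Rightarrow> 'a \<Rightarrow> 'a" where
  "ominusB b x y = (x - y) / (1 + b * y)"

definition uminusB :: "'a::{comm_ring_1,inverse} \<Rightarrow> 'a \<Rightarrow> 'a" where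
  "uminusB b x = - x / (1 + b * x)"

definition part_box :: "nat \<Rightarrow> nat \<Rightarrow> (nat \<Rightarrow> nat) \<Rightarrow> bool" where
  "part_box n k lam \<longleftrightarrow> lam 0 = 0 \<and> (\<forall>i\<ge>1. lam (Suc i) \<le> lam i)
      \<and> (\<forall>i. lam i \<le> k) \<and> (\<forall>i>n. lam i = 0)"

definition Iset :: "nat \<Rightarrow> (nat \<Rightarrow> nat) \<Rightarrow> nat set" where
  "Iset n lam = {lam (n + 1 - i) + i | i. 1 \<le> i \<and> i \<le> n}"

text \<open>Inverse of Iset: the partition whose set is I (I of size n).\<close>
definition part_of_set :: "nat \<Rightarrow> nat set \<Rightarrow> (nat \<Rightarrow> nat)" where
  "part_of_set n I = (\<lambda>r. if 1 \<le> r \<and> r \<le> n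
       then sorted_list_of_set I ! (n - r) - (n + 1 - r) else 0)"

text \<open>s_j lam: swap the j-th and (j+1)-th letters of the binary string.\<close>
definition sj_part :: "nat \<Rightarrow> nat \<Rightarrow> (nat \<Rightarrow> nat) \<Rightarrow> (nat \<Rightarrow> nat)" where
  "sj_part n j lam = part_of_set n (swapj j ` Iset n lam)"

definition boxes :: "(nat \<Rightarrow> nat) \<Rightarrow> (nat \<times> nat) set" where
  "boxes lam = {(i, j). 1 \<le> i \<and> 1 \<le> j \<and> j \<le> lam i}"

definition svt :: "nat \<Rightarrow> (nat \<Rightarrow> nat) \<Rightarrow> (nat \<times> nat \<Rightarrow> nat set) set" where
  "svt n lam = {T. (\<forall>b\<in>boxes lam. T b \<noteq> {} \<and> T b \<subseteq> {1..n})
     \<and> (\<forall>b. b \<notin> boxes lam \<longrightarrow> T b = {})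
     \<and> (\<forall>i j. (i, j) \<in> boxes lam \<and> (i, Suc j) \<in> boxes lam
            \<longrightarrow> Max (T (i, j)) \<le> Min (T (i, Suc j)))
     \<and> (\<forall>i j. (i, j) \<in> boxes lam \<and> (Suc i, j) \<in> boxes lam
            \<longrightarrow> Max (T (i, j)) < Min (T (Suc i, j)))}"

definition tsize :: "(nat \<Rightarrow> nat) \<Rightarrow> (nat \<times> nat \<Rightarrow> nat set) \<Rightarrow> nat" where
  "tsize lam T = (\<Sum>b\<in>boxes lam. card (T b))"

definition Groth :: "'a::comm_ring_1 \<Rightarrow> nat \<Rightarrow> (nat \<Rightarrow> nat) \<Rightarrow> (nat \<Rightarrow> 'a) \<Rightarrow> (nat \<Rightarrow> 'a) \<Rightarrow> 'a" where
  "Groth b n lam x s = (\<Sum>T\<in>svt n lam. b ^ (tsize lam T - card (boxes lam)) *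
      (\<Prod>(i, j)\<in>boxes lam. \<Prod>r\<in>T (i, j). oplusB b (x r) (s (r + j - i))))"

definition bethe_eqs :: "nat \<Rightarrow> nat \<Rightarrow> nat set \<Rightarrow> (nat \<Rightarrow> rf fps) \<Rightarrow> bool" where
  "bethe_eqs n N I y \<longleftrightarrow> (\<forall>i\<in>I.
     (-1) ^ n * (\<Prod>l\<in>I. 1 + fps_const betaK * y l) / (1 + fps_const betaK * y i) ^ n
       * (\<Prod>m\<in>{1..N}. ominusB (fps_const betaK) (y i) (fps_const (tK N m))) + fps_X = 0)"

text \<open>The unique solution y_nu = (y_i)_(i in I_nu) with y_i = t_i mod q
  (components outside I_nu set to 0 for definiteness).\<close>
definition bethe_root :: "nat \<Rightarrow> nat \<Rightarrow> (nat \<Rightarrow> nat) \<Rightarrow> (nat \<Rightarrow> rf fps)" where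
  "bethe_root n N nu = (THE y. (\<forall>i\<in>Iset n nu. fps_nth (y i) 0 = tK N i)
      \<and> (\<forall>i. i \<notin> Iset n nu \<longrightarrow> y i = 0) \<and> bethe_eqs n N (Iset n nu) y)"

definition G_at :: "nat \<Rightarrow> nat \<Rightarrow> (nat \<Rightarrow> nat) \<Rightarrow> (nat \<Rightarrow> nat) \<Rightarrow> rf fps" where
  "G_at n N lam nu = Groth (fps_const betaK) n lam
      (\<lambda>r. bethe_root n N nu (sorted_list_of_set (Iset n nu) ! (r - 1)))
      (\<lambda>m. fps_const (uminusB betaK (tK N m)))"

end

theory Submission
  imports Defs
begin

text \<open>
  Removing the letter n + 1 from a set-valued tableau with entries in 1, ..., n + 1 leaves a tableau
  on an interlacing shape, and the weight of what is removed factors over the columns of one lattice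
  row whose upper and lower boundary words are the 01-words of the two shapes. Hence G_lambda is the
  partition function of a five-vertex model with row parameters x_r and column parameters s_p. Read
  column by column it is a product over p of operators A(s_p) or B(s_p), according to whether p lies
  outside or inside I_lambda. Exchanging s = s_j and s' = s_(j+1) only involves the quadratic relations
  A(s)A(s') = A(s')A(s), B(s)B(s') = B(s')B(s), B(s)A(s') = B(s')A(s) and
  (1 + beta s')A(s)B(s') - (1 + beta s)A(s')B(s) = (s - s')B(s)A(s'), which follow by induction on the
  number of rows; they yield the difference formula for arbitrary x.

  The Bethe equations enter only through uniqueness: s_j maps the root of s_j mu to a solution of the
  equations for mu, so it permutes the components of y_mu. This permutation is trivial unless j and
  j + 1 both lie in I_mu; then it exchanges two adjacent arguments of G_lambda, and G_lambda is
  symmetric in x because the R-matrix of two adjacent rows commutes with all columns.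
\<close>

section \<open>Column operators of the five-vertex model\<close>

text \<open>In a tableau the letter r meets the parameter of index r + j - i, which mixes variables
  and parameters; neither the symmetry in x nor an exchange of two parameters is visible there. The
  lattice separates them: x_r is constant along a row, s_p along a column, and the same sum can be
  cut either way. Tableaux give the cut into rows, the action of s_j concerns the cut into columns,
  and \<open>colops_Cons\<close> links the two.

  Both exchanges are proved over any commutative ring and therefore carry a factor,
  \<open>1 + b * s j\<close> for columns and \<open>1 + b * x\<close> for rows, which is cancelled
  only at the end. At s = -t/(1 + beta t) the first factor is 1/(1 + beta t_j), and dividing by it
  turns s_(j+1) - s_j into (t_j - t_(j+1))/(1 + beta t_(j+1)). The second is nonzero at the Bethe
  root because its constant term in q is 1 + beta t_j.\<close>

text \<open>
  One lattice column with parameter s, acting on functions of the horizontal edges to its right; the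
  head of a state belongs to the bottom row, whose variable is the head of the list of variables, and
  the flag d is the edge below the column. As block matrices over the bottom row, with
  u = x + s + beta x s, the operators A (d = False) and B (d = True) of n + 1 rows are
  [[A, (1 + beta u)B], [0, u A]] and [[0, 0], [A, B]] in terms of those of n rows.
\<close>
fun colop :: "'a::comm_ring_1 \<Rightarrow> 'a list \<Rightarrow> bool \<Rightarrow> 'a \<Rightarrow> (bool list \<Rightarrow> 'a) \<Rightarrow> bool list \<Rightarrow> 'a"
where
  "colop b [] d s f h = (if d then 0 else f h)"
| "colop b (x # xs) d s f [] = 0"
| "colop b (x # xs) False s f (False # h) = colop b xs False s (\<lambda>g. f (False # g)) h
     + (1 + b * oplusB b x s) * colop b xs True s (\<lambda>g. f (True # g)) h"
| "colop b (x # xs) False s f (True # h) =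
     oplusB b x s * colop b xs False s (\<lambda>g. f (True # g)) h"
| "colop b (x # xs) True s f (False # h) = 0"
| "colop b (x # xs) True s f (True # h) =
     colop b xs False s (\<lambda>g. f (False # g)) h + colop b xs True s (\<lambda>g. f (True # g)) h"

lemma colop_linear:
  "colop b xs d s (\<lambda>h. f h + g h) h = colop b xs d s f h + colop b xs d s g h"
  "colop b xs d s (\<lambda>h. c * f h) h = c * colop b xs d s f h"
  "colop b xs d s (\<lambda>h. 0) h = 0"
proof -
  show "colop b xs d s (\<lambda>h. f h + g h) h = colop b xs d s f h + colop b xs d s g h"
  proof (induction xs arbitrary: d f g h)
    case (Cons x xs)
    show ?case by (cases h; cases "hd h"; cases d) (simp_all add: Cons algebra_simps)
  qed simp
  show scale: "colop b xs d s (\<lambda>h. c * f h) h = c * colop b xs d s f h" for c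
  proof (induction xs arbitrary: d f h)
    case (Cons x xs)
    show ?case by (cases h; cases "hd h"; cases d) (simp_all add: Cons algebra_simps)
  qed simp
  show "colop b xs d s (\<lambda>h. 0) h = 0"
    using scale[of 0] by simp
qed

text \<open>The relations support each other: in block form over the bottom row, commutation of the
  A's reduces to the mixed relation for the remaining rows, and symmetry of BA to the mixed relation
  and commutation of the A's. Hence the simultaneous induction.\<close>

lemma colop_relations:
  shows "colop b xs False s (colop b xs False s' f) h = colop b xs False s' (colop b xs False s f) h"
    and "colop b xs True s (colop b xs True s' f) h = colop b xs True s' (colop b xs True s f) h"
    and "colop b xs True s (colop b xs False s' f) h = colop b xs True s' (colop b xs False s f) h"
    and "(1 + b * s') * colop b xs False s (colop b xs True s' f) h
           - (1 + b * s) * colop b xs False s' (colop b xs True s f) h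
         = (s - s') * colop b xs True s (colop b xs False s' f) h"
proof (induction xs arbitrary: f h)
  case Nil
  { case 1 show ?case by simp }
  { case 2 show ?case by simp }
  { case 3 show ?case by simp }
  { case 4 show ?case by simp }
next
  case (Cons x xs)
  note IH = Cons
  define AB AB' where "AB = (\<lambda>f h. colop b xs False s (colop b xs True s' f) h)"
    and "AB' = (\<lambda>f h. colop b xs False s' (colop b xs True s f) h)"
  define BA where "BA = (\<lambda>f h. colop b xs True s (colop b xs False s' f) h)"
  \<comment> \<open>By the third relation BA is symmetric in the two parameters, so one name serves
    both orders and they become the same atom for the simplifier.\<close>
  have BA': "colop b xs True s' (colop b xs False s g) h = BA g h" for g h
    unfolding BA_def by (rule IH(3)[symmetric])
  have R: "(1 + b * s') * AB g h - (1 + b * s) * AB' g h = (s - s') * BA g h" for g h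
    unfolding AB_def AB'_def BA_def by (rule IH(4))
  \<comment> \<open>With u = x + s + b x s and u' likewise from s', 1 + b u = (1 + b x)(1 + b s) and
    u - u' = (1 + b x)(s - s'). So the coefficients of the mixed relation only acquire a factor 1 +
    b x when both parameters are translated by x.\<close>
  have R2: "(1 + b * oplusB b x s') * AB g h - (1 + b * oplusB b x s) * AB' g h
      = (oplusB b x s - oplusB b x s') * BA g h" for g h
    using arg_cong[OF R[of g h], of "\<lambda>z. (1 + b * x) * z"] by (simp add: oplusB_def algebra_simps)
  note defs = BA'
    fun_cong[OF fun_cong[OF AB_def], symmetric] fun_cong[OF fun_cong[OF AB'_def], symmetric]
    fun_cong[OF fun_cong[OF BA_def], symmetric]
  have rule: "P h" if "P []" "\<And>g. P (False # g)" "\<And>g. P (True # g)" for P and h :: "bool list"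
    using that by (metis (full_types) neq_Nil_conv)
  {
    case 1 show ?case
    proof (induction h rule: rule)
      case (2 g)
      show ?case using R2[of "\<lambda>g. f (True # g)" g] by (simp add: colop_linear defs IH(1) algebra_simps)
    next
      case (3 g)
      show ?case by (simp add: colop_linear defs IH(1))
    qed simp
  next
    case 2 show ?case
    proof (induction h rule: rule)
      case (3 g)
      show ?case by (simp add: colop_linear defs IH(2))
    qed simp_all
  next
    case 3 show ?case
    proof (induction h rule: rule)
      case (3 g)
      show ?case using R2[of "\<lambda>g. f (True # g)" g] by (simp add: colop_linear defs IH(1) algebra_simps)
    qed simp_all
  next
    case 4 show ?case
    proof (induction h rule: rule)
      case (2 g)
      show ?case
        by (simp add: colop_linear defs IH(2) oplusB_def algebra_simps)
    next
      case (3 g)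
      show ?case using arg_cong[OF R[of "\<lambda>g. f (True # g)" g], of "\<lambda>z. oplusB b x s' * z"]
        by (simp add: colop_linear defs IH(1) oplusB_def algebra_simps)
    qed simp
  }
qed

section \<open>The partition function and the exchange of two column parameters\<close>

definition vac :: "nat \<Rightarrow> bool list \<Rightarrow> 'a::comm_ring_1" where
  "vac m h = of_bool (h = replicate m False)"

abbreviation colops :: "'a::comm_ring_1 \<Rightarrow> 'a list \<Rightarrow> nat set \<Rightarrow> (nat \<Rightarrow> 'a) \<Rightarrow> nat list \<Rightarrow> (bool list \<Rightarrow> 'a) \<Rightarrow> bool list \<Rightarrow> 'a"
  where "colops b xs I s ps \<equiv> foldr (\<lambda>p. colop b xs (p \<in> I) (s p)) ps"

text \<open>Boundary conditions: a path enters every row from the left (the all-True state), none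
  leaves on the right (\<open>vac\<close>), and the paths leave downwards in the columns of I.
  Column 1 is leftmost, and the head of \<open>xs\<close> belongs to the bottom row.\<close>

definition lattice_sum :: "'a::comm_ring_1 \<Rightarrow> 'a list \<Rightarrow> nat set \<Rightarrow> (nat \<Rightarrow> 'a) \<Rightarrow> nat \<Rightarrow> 'a" where
  "lattice_sum b xs I s P =
     colops b xs I s [1..<Suc P] (vac (length xs)) (replicate (length xs) True)"

lemma colops_linear:
  "colops b xs I s ps (\<lambda>h. f h + g h) h = colops b xs I s ps f h + colops b xs I s ps g h"
  "colops b xs I s ps (\<lambda>h. c * f h) h = c * colops b xs I s ps f h"
proof -
  show "colops b xs I s ps (\<lambda>h. f h + g h) h = colops b xs I s ps f h + colops b xs I s ps g h"
  proof (induction ps arbitrary: h)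
    case (Cons p ps)
    have "colops b xs I s ps (\<lambda>h. f h + g h) = (\<lambda>h. colops b xs I s ps f h + colops b xs I s ps g h)"
      using Cons by blast
    then show ?case by (simp add: colop_linear)
  qed simp
  show "colops b xs I s ps (\<lambda>h. c * f h) h = c * colops b xs I s ps f h"
  proof (induction ps arbitrary: h)
    case (Cons p ps)
    have "colops b xs I s ps (\<lambda>h. c * f h) = (\<lambda>h. c * colops b xs I s ps f h)"
      using Cons by blast
    then show ?case by (simp add: colop_linear)
  qed simp
qed

lemma upt_split_pair:
  assumes "1 \<le> j" "j < P"
  shows "[1..<Suc P] = [1..<j] @ j # Suc j # [Suc (Suc j)..<Suc P]"
proof -
  have "[1..<Suc P] = [1..<j] @ [j..<Suc P]"
    using assms by (metis upt_add_eq_append le_add_diff_inverse less_imp_le_nat less_SucI)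
  then show ?thesis using assms by (simp add: upt_conv_Cons)
qed

text \<open>Isolates two neighbouring columns between unchanged ones. Allowing both another set and
  other parameters lets one form cover the original sum, the sum with exchanged parameters and the
  sum with exchanged letters.\<close>

lemma lattice_sum_split:
  assumes j: "1 \<le> j" "j < P" and J: "\<And>p. p \<noteq> j \<Longrightarrow> p \<noteq> Suc j \<Longrightarrow> p \<in> J \<longleftrightarrow> p \<in> I"
    and s': "\<And>p. p \<noteq> j \<Longrightarrow> p \<noteq> Suc j \<Longrightarrow> s' p = s p"
  shows "lattice_sum b xs J s' P =
    colops b xs I s [1..<j] (colop b xs (j \<in> J) (s' j) (colop b xs (Suc j \<in> J) (s' (Suc j))
       (colops b xs I s [Suc (Suc j)..<Suc P] (vac (length xs))))) (replicate (length xs) True)"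
proof -
  have eq: "colops b xs J s' ps = colops b xs I s ps" if "\<forall>p\<in>set ps. p \<noteq> j \<and> p \<noteq> Suc j" for ps
    by (rule ext, rule foldr_cong) (use that J s' in auto)
  show ?thesis
    unfolding lattice_sum_def upt_split_pair[OF j] foldr_append foldr.simps o_apply
    using eq[of "[1..<j]"] eq[of "[Suc (Suc j)..<Suc P]"] by (simp del: upt_Suc)
qed

lemma lattice_sum_swap:
  fixes b :: "'a::comm_ring_1"
  assumes j: "1 \<le> j" "j < P"
  shows "\<not> (j \<notin> I \<and> Suc j \<in> I) \<Longrightarrow>
      lattice_sum b xs I (\<lambda>p. s (swapj j p)) P = lattice_sum b xs I s P"
    and "j \<notin> I \<Longrightarrow> Suc j \<in> I \<Longrightarrow>
      (1 + b * s j) * (lattice_sum b xs I (\<lambda>p. s (swapj j p)) P - lattice_sum b xs I s P) =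
      (s (Suc j) - s j) * (b * lattice_sum b xs I s P + lattice_sum b xs (swapj j ` I) s P)"
proof -
  define R where "R = colops b xs I s [Suc (Suc j)..<Suc P] (vac (length xs))"
  define L where "L = (\<lambda>f. colops b xs I s [1..<j] f (replicate (length xs) True))"
  note split = lattice_sum_split[OF j, where I = I and s = s and b = b and xs = xs,
      folded R_def L_def[THEN fun_cong]]
  have Z: "lattice_sum b xs I s P =
      L (colop b xs (j \<in> I) (s j) (colop b xs (Suc j \<in> I) (s (Suc j)) R))"
    by (subst split) (auto simp: L_def)
  have Z': "lattice_sum b xs I (\<lambda>p. s (swapj j p)) P =
      L (colop b xs (j \<in> I) (s (Suc j)) (colop b xs (Suc j \<in> I) (s j) R))"
    by (subst split) (auto simp: L_def swapj_def)
  show "lattice_sum b xs I (\<lambda>p. s (swapj j p)) P = lattice_sum b xs I s P"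
    if "\<not> (j \<notin> I \<and> Suc j \<in> I)"
  proof -
    \<comment> \<open>The remaining words at j and j + 1 give AA, BB and BA, the first three
      relations.\<close>
    have "colop b xs (j \<in> I) (s (Suc j)) (colop b xs (Suc j \<in> I) (s j) R) =
        colop b xs (j \<in> I) (s j) (colop b xs (Suc j \<in> I) (s (Suc j)) R)"
      using that colop_relations(1-3)[of b xs "s (Suc j)" "s j" R]
      by (intro ext, cases "j \<in> I"; cases "Suc j \<in> I") auto
    then show ?thesis unfolding Z Z' by simp
  qed
  assume I: "j \<notin> I" "Suc j \<in> I"
  have "p \<in> swapj j ` I \<longleftrightarrow> swapj j p \<in> I" for p
    by (force simp: swapj_def image_iff)
  then have W: "lattice_sum b xs (swapj j ` I) s P =
      L (colop b xs True (s j) (colop b xs False (s (Suc j)) R))"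
    using I by (subst split) (auto simp: L_def swapj_def)
  \<comment> \<open>The mixed relation is stated between functions because L, the product of the
    columns to the left, acts on functions and not on single values.\<close>
  have "(\<lambda>h. (1 + b * s j) * colop b xs False (s (Suc j)) (colop b xs True (s j) R) h) =
     (\<lambda>h. (1 + b * s (Suc j)) * colop b xs False (s j) (colop b xs True (s (Suc j)) R) h
        + (s (Suc j) - s j) * colop b xs True (s j) (colop b xs False (s (Suc j)) R) h)"
    using colop_relations(4)[of b "s (Suc j)" xs "s j" R] by (intro ext) (simp add: algebra_simps)
  then have "L (\<lambda>h. (1 + b * s j) * colop b xs False (s (Suc j)) (colop b xs True (s j) R) h) =
     L (\<lambda>h. (1 + b * s (Suc j)) * colop b xs False (s j) (colop b xs True (s (Suc j)) R) h
        + (s (Suc j) - s j) * colop b xs True (s j) (colop b xs False (s (Suc j)) R) h)"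
    by simp
  then have "(1 + b * s j) * lattice_sum b xs I (\<lambda>p. s (swapj j p)) P =
      (1 + b * s (Suc j)) * lattice_sum b xs I s P + (s (Suc j) - s j) * lattice_sum b xs (swapj j ` I) s P"
    unfolding Z Z' W using I by (simp add: L_def colops_linear)
  \<comment> \<open>Writing 1 + b s_(j+1) = (1 + b s_j) + b (s_(j+1) - s_j) produces the term with
    the coefficient beta in the formula.\<close>
  then show "(1 + b * s j) * (lattice_sum b xs I (\<lambda>p. s (swapj j p)) P - lattice_sum b xs I s P) =
      (s (Suc j) - s j) * (b * lattice_sum b xs I s P + lattice_sum b xs (swapj j ` I) s P)"
    by (simp add: algebra_simps)
qed

section \<open>Exchange of two adjacent rows\<close>

text \<open>
  The R-matrix acting on the adjacent rows with variables y and x that lie k rows above the bottom row.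
\<close>
fun rop :: "'a::comm_ring_1 \<Rightarrow> 'a \<Rightarrow> 'a \<Rightarrow> nat \<Rightarrow> (bool list \<Rightarrow> 'a) \<Rightarrow> bool list \<Rightarrow> 'a" where
  "rop b x y 0 f (c # d # h) =
     (if c \<and> \<not> d then (y - x) * f (False # True # h) + (1 + b * x) * f (True # False # h)
      else (1 + b * (if d \<and> \<not> c then y else x)) * f (c # d # h))"
| "rop b x y 0 f _ = 0"
| "rop b x y (Suc k) f (e # h) = rop b x y k (\<lambda>g. f (e # g)) h"
| "rop b x y (Suc k) f [] = 0"

lemma rop_linear:
  "rop b x y k (\<lambda>h. f h + g h) h = rop b x y k f h + rop b x y k g h"
  "rop b x y k (\<lambda>h. c * f h) h = c * rop b x y k f h"
  "rop b x y k (\<lambda>h. 0) h = 0"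
proof -
  show "rop b x y k (\<lambda>h. f h + g h) h = rop b x y k f h + rop b x y k g h"
  proof (induction k arbitrary: f g h)
    case 0
    show ?case by (cases h; cases "tl h") (simp_all add: algebra_simps)
  next
    case (Suc k)
    show ?case by (cases h) (simp_all add: Suc)
  qed
  show scale: "rop b x y k (\<lambda>h. c * f h) h = c * rop b x y k f h" for c
  proof (induction k arbitrary: f h)
    case 0
    show ?case by (cases h; cases "tl h") (simp_all add: algebra_simps)
  next
    case (Suc k)
    show ?case by (cases h) (simp_all add: Suc)
  qed
  show "rop b x y k (\<lambda>h. 0) h = 0"
    using scale[of 0] by simp
qed

text \<open>The Yang-Baxter relation as an intertwiner: moving the R-matrix through a column
  exchanges the two row variables. Rows below are peeled off by both recursions in the same way;
  rows above enter only through linearity of \<open>colop\<close>, so the base case is a finite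
  check.\<close>

lemma colop_rop:
  "colop b (us @ y # x # vs) d s (rop b x y (length us) f) h =
   rop b x y (length us) (colop b (us @ x # y # vs) d s f) h"
proof (induction us arbitrary: d f h)
  case Nil
  show ?case
  proof (cases h)
    case (Cons e h')
    then show ?thesis
      by (cases h'; cases "hd h'"; cases e; cases d)
        (simp_all add: colop_linear, simp_all add: oplusB_def algebra_simps)
  qed simp
next
  case (Cons u us)
  show ?case
  proof (cases h)
    case (Cons e h')
    then show ?thesis
      by (cases e; cases d) (simp_all add: Cons.IH rop_linear)
  qed simp
qed

text \<open>The R-matrix mixes only the two states with exactly one occupied edge, so the empty
  state is an eigenvector. Its eigenvalue agrees with the factor picked up at the full state on the
  left boundary.\<close>

lemma rop_vac: "k + 2 \<le> m \<Longrightarrow> rop b x y k (vac m) h = (1 + b * x) * vac m h"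
proof (induction k arbitrary: m h)
  case 0
  then obtain m' where "m = Suc (Suc m')" by (metis add_2_eq_Suc le_Suc_ex add_0)
  then show ?case by (cases h; cases "tl h") (auto simp: vac_def)
next
  case (Suc k)
  then obtain m' where m: "m = Suc m'" by (cases m) auto
  show ?case
  proof (cases h)
    case (Cons e h')
    have "(vac m (e # g) :: 'a) = (if e then 0 else vac m' g)" for g
      by (simp add: vac_def m)
    then show ?thesis using Suc m Cons by (cases e) (simp_all add: rop_linear)
  qed (simp add: vac_def m)
qed

text \<open>The R-matrix is inserted at the right boundary, moved through all columns and evaluated
  at the left boundary; both boundaries turn it into 1 + b x. This factor stays in the statement
  since it may be a zero divisor.\<close>

lemma lattice_sum_exchange:
  "(1 + b * x) * lattice_sum b (us @ y # x # vs) I s P = (1 + b * x) * lattice_sum b (us @ x # y # vs) I s P"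
proof -
  define m where "m = length us + 2 + length vs"
  have *: "colops b (us @ y # x # vs) I s ps (rop b x y (length us) f) =
      rop b x y (length us) (colops b (us @ x # y # vs) I s ps f)" for ps f
    by (induction ps) (simp_all add: colop_rop[THEN ext])
  have True: "rop b x y k f (replicate m True) = (1 + b * x) * f (replicate m True)"
    if "k + 2 \<le> m" for k m and f :: "bool list \<Rightarrow> 'a"
    using that
  proof (induction k arbitrary: m f)
    case 0
    then obtain m' where "m = Suc (Suc m')" by (metis add_2_eq_Suc le_Suc_ex add_0)
    then show ?case by simp
  next
    case (Suc k)
    then obtain m' where "m = Suc m'" by (cases m) auto
    then show ?case using Suc by simp
  qed
  have vac: "rop b x y (length us) (vac m) = (\<lambda>h. (1 + b * x) * vac m h)"
    by (rule ext, rule rop_vac) (simp add: m_def)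
  have "(1 + b * x) * lattice_sum b (us @ y # x # vs) I s P =
      colops b (us @ y # x # vs) I s [1..<Suc P] (rop b x y (length us) (vac m)) (replicate m True)"
    unfolding vac by (subst colops_linear(2)) (simp add: lattice_sum_def m_def del: upt_Suc replicate.simps)
  also have "\<dots> = (1 + b * x) * colops b (us @ x # y # vs) I s [1..<Suc P] (vac m) (replicate m True)"
    unfolding * by (rule True) (simp add: m_def)
  finally show ?thesis
    unfolding lattice_sum_def by (simp add: m_def del: upt_Suc replicate.simps)
qed

section \<open>Expansion along a lattice row\<close>

text \<open>The horizontal edge to the right of column p in a row with upper word J and lower word I.\<close>
fun edge :: "nat set \<Rightarrow> nat set \<Rightarrow> nat \<Rightarrow> bool" where
  "edge J I 0 = True"
| "edge J I (Suc p) = (if edge J I p then Suc p \<in> J \<or> Suc p \<notin> I else Suc p \<in> J)"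

text \<open>The flags are the edges to the left, above and below. Six configurations conserve paths;
  the one in which a path runs straight down past empty horizontal edges gets weight 0, which leaves
  five vertices. Weight 0 also removes the words for which no right edge conserves paths.\<close>

definition vertex :: "'a::comm_ring_1 \<Rightarrow> 'a \<Rightarrow> bool \<Rightarrow> bool \<Rightarrow> bool \<Rightarrow> 'a" where
  "vertex b u e m d =
     (if e then if d then 1 else if m then 0 else u
      else if d then 0 else if m then 1 + b * u else 1)"

definition row_weight :: "'a::comm_ring_1 \<Rightarrow> 'a \<Rightarrow> nat set \<Rightarrow> nat set \<Rightarrow> (nat \<Rightarrow> 'a) \<Rightarrow> nat \<Rightarrow> 'a" where
  "row_weight b x J I s q =
     (\<Prod>p\<in>{1..q}. vertex b (oplusB b x (s p)) (edge J I (p - 1)) (p \<in> J) (p \<in> I))"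

lemma edge_cong: "(\<And>i. i \<le> p \<Longrightarrow> i \<in> J \<longleftrightarrow> i \<in> J') \<Longrightarrow> edge J I p = edge J' I p"
  by (induction p) simp_all

lemma colop_Cons_eq_vertex:
  "colop b (x # xs) (p \<in> I) s f (e # h) =
     (\<Sum>m\<in>{False, True}. vertex b (oplusB b x s) e m (p \<in> I) *
        colop b xs m s (\<lambda>g. f ((if e then m \<or> p \<notin> I else m) # g)) h)"
  by (cases e; cases "p \<in> I") (simp_all add: vertex_def)

lemma sum_Pow_Suc:
  "(\<Sum>J\<in>Pow {1..Suc q}. F J) = (\<Sum>J\<in>Pow {1..q}. F J + F (insert (Suc q) J))"
proof -
  have "{1..Suc q} = insert (Suc q) {1..q}" by auto
  then have *: "Pow {1..Suc q} = Pow {1..q} \<union> insert (Suc q) ` Pow {1..q}"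
    by (simp add: Pow_insert)
  have "inj_on (insert (Suc q)) (Pow {1..q})"
  proof (rule inj_onI)
    fix A B assume "A \<in> Pow {1..q}" "B \<in> Pow {1..q}" and eq: "insert (Suc q) A = insert (Suc q) B"
    then have "Suc q \<notin> A" "Suc q \<notin> B" by auto
    then show "A = B" using eq by (simp add: insert_ident)
  qed
  moreover have "Pow {1..q} \<inter> insert (Suc q) ` Pow {1..q} = {}"
    by auto
  ultimately show ?thesis
    unfolding * by (subst sum.union_disjoint) (simp_all add: sum.reindex sum.distrib)
qed

text \<open>J collects the vertical edges just above the bottom row. The induction appends the last
  column, which acts on F first, so F must be arbitrary; the new vertical edge decides whether
  \<open>Suc q\<close> joins J.\<close>

lemma colops_Cons:
  "colops b (x # xs) I s [1..<Suc q] F (True # h) =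
     (\<Sum>J\<in>Pow {1..q}. row_weight b x J I s q *
        colops b xs J s [1..<Suc q] (\<lambda>g. F (edge J I q # g)) h)"
proof (induction q arbitrary: F)
  case 0
  show ?case by (simp add: row_weight_def)
next
  case (Suc q)
  have upt: "[1..<Suc (Suc q)] = [1..<Suc q] @ [Suc q]" by simp
  define G where "G = (\<lambda>J. row_weight b x J I s (Suc q) *
        colops b xs J s [1..<Suc (Suc q)] (\<lambda>g. F (edge J I (Suc q) # g)) h)"
  have "colops b (x # xs) I s [1..<Suc (Suc q)] F (True # h) =
     (\<Sum>J\<in>Pow {1..q}. row_weight b x J I s q * colops b xs J s [1..<Suc q]
         (\<lambda>g. colop b (x # xs) (Suc q \<in> I) (s (Suc q)) F (edge J I q # g)) h)"
    using Suc.IH[of "colop b (x # xs) (Suc q \<in> I) (s (Suc q)) F"]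
    unfolding upt foldr_append by (simp del: upt_Suc)
  also have "\<dots> = (\<Sum>J\<in>Pow {1..q}. G J + G (insert (Suc q) J))"
  proof (rule sum.cong[OF refl])
    fix J assume "J \<in> Pow {1..q}"
    then have J: "J \<subseteq> {1..q}" by simp
    then have nJ: "Suc q \<notin> J" by auto
    define J' where "J' = insert (Suc q) J"
    have e: "edge J' I p = edge J I p" if "p \<le> q" for p
      by (rule edge_cong) (use that in \<open>auto simp: J'_def\<close>)
    define w where "w = (\<lambda>m. vertex b (oplusB b x (s (Suc q))) (edge J I q) m (Suc q \<in> I))"
    define r where "r = row_weight b x J I s q"
    have r': "row_weight b x J' I s q = r"
      unfolding row_weight_def r_def
      by (rule prod.cong) (use nJ in \<open>auto simp: e[unfolded J'_def] J'_def\<close>)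
    have rw: "row_weight b x J I s (Suc q) = r * w False" "row_weight b x J' I s (Suc q) = r * w True"
    proof -
      have "{1..Suc q} = insert (Suc q) {1..q}" by auto
      then have *: "row_weight b x K I s (Suc q) = row_weight b x K I s q *
          vertex b (oplusB b x (s (Suc q))) (edge K I q) (Suc q \<in> K) (Suc q \<in> I)" for K
        by (simp add: row_weight_def mult.commute)
      show "row_weight b x J I s (Suc q) = r * w False" "row_weight b x J' I s (Suc q) = r * w True"
        using nJ by (simp_all add: * r_def[symmetric] r' w_def e) (simp add: J'_def)
    qed
    have c: "colops b xs J' s [1..<Suc q] = colops b xs J s [1..<Suc q]"
      by (rule ext, rule foldr_cong) (auto simp: J'_def)
    show "row_weight b x J I s q * colops b xs J s [1..<Suc q]
         (\<lambda>g. colop b (x # xs) (Suc q \<in> I) (s (Suc q)) F (edge J I q # g)) h = G J + G (insert (Suc q) J)"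
    proof -
      define f0 f1 where "f0 = colop b xs False (s (Suc q)) (\<lambda>g. F (edge J I (Suc q) # g))"
        and "f1 = colop b xs True (s (Suc q)) (\<lambda>g. F (edge J' I (Suc q) # g))"
      have J'q: "Suc q \<in> J'" by (simp add: J'_def)
      have step: "colop b (x # xs) (Suc q \<in> I) (s (Suc q)) F (edge J I q # g) =
          w False * f0 g + w True * f1 g" for g
        unfolding colop_Cons_eq_vertex using nJ J'q by (simp add: w_def f0_def f1_def e)

      have "G J = r * w False * colops b xs J s [1..<Suc q] f0 h"
        unfolding G_def rw upt foldr_append f0_def using nJ by (simp del: upt_Suc edge.simps)
      moreover have "G J' = r * w True * colops b xs J s [1..<Suc q] f1 h"
        unfolding G_def rw upt foldr_append f1_def using J'q c by (simp del: upt_Suc edge.simps)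
      ultimately show ?thesis
        unfolding step colops_linear r_def[symmetric] J'_def[symmetric] by (simp add: distrib_left mult.assoc)
    qed
  qed
  also have "\<dots> = (\<Sum>J\<in>Pow {1..Suc q}. G J)"
    by (rule sum_Pow_Suc[symmetric])
  finally show ?case unfolding G_def .
qed

lemma lattice_sum_Cons:
  fixes b :: "'a::comm_ring_1"
  shows "lattice_sum b (x # xs) I s P =
     (\<Sum>J\<in>Pow {1..P}. if edge J I P then 0 else row_weight b x J I s P * lattice_sum b xs J s P)"
proof -
  have "(\<lambda>g. vac (Suc (length xs)) (e # g) :: 'a) = (\<lambda>g. (if e then 0 else 1) * vac (length xs) g)" for e
    by (auto simp: vac_def fun_eq_iff)
  then show ?thesis
    unfolding lattice_sum_def length_Cons replicate.simps colops_Cons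
    by (intro sum.cong[OF refl]) (simp add: colops_linear del: upt_Suc)
qed

lemma lattice_sum_Nil: "lattice_sum b [] I s P = of_bool (I \<inter> {1..P} = {})"
proof -
  have "colops b [] I s ps f h = (if I \<inter> set ps = {} then f h else 0)" for ps f h
    by (induction ps) auto
  then show ?thesis by (simp add: lattice_sum_def vac_def atLeastLessThanSuc_atLeastAtMost del: upt_Suc)
qed

section \<open>Branching of set-valued tableaux\<close>

lemma finite_boxes: "(\<And>i. i > m \<Longrightarrow> lam i = 0) \<Longrightarrow> finite (boxes lam)"
proof -
  assume m: "\<And>i. i > m \<Longrightarrow> lam i = 0"
  have "boxes lam \<subseteq> (\<Union>i\<in>{1..m}. {i} \<times> {1..lam i})"
  proof
    fix c assume "c \<in> boxes lam"
    then obtain i j where "c = (i, j)" "1 \<le> i" "1 \<le> j" "j \<le> lam i" by (auto simp: boxes_def)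
    moreover from this have "i \<le> m" using m[of i] by (cases "i \<le> m") auto
    ultimately show "c \<in> (\<Union>i\<in>{1..m}. {i} \<times> {1..lam i})" by auto
  qed
  then show ?thesis by (rule finite_subset) auto
qed

text \<open>For nonempty finite sets the conditions on Max and Min are conditions on all pairs of
  entries. In this form they pass to subsets, so deleting a letter requires no new extrema.\<close>

lemma svt_iff:
  "T \<in> svt n lam \<longleftrightarrow> (\<forall>c\<in>boxes lam. T c \<noteq> {} \<and> T c \<subseteq> {1..n}) \<and> (\<forall>c. c \<notin> boxes lam \<longrightarrow> T c = {})
     \<and> (\<forall>i j. (i, j) \<in> boxes lam \<and> (i, Suc j) \<in> boxes lam \<longrightarrow>
           (\<forall>p\<in>T (i, j). \<forall>r\<in>T (i, Suc j). p \<le> r))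
     \<and> (\<forall>i j. (i, j) \<in> boxes lam \<and> (Suc i, j) \<in> boxes lam \<longrightarrow>
           (\<forall>p\<in>T (i, j). \<forall>r\<in>T (Suc i, j). p < r))"
proof (cases "\<forall>c\<in>boxes lam. T c \<noteq> {} \<and> T c \<subseteq> {1..n}")
  case True
  then have fin: "finite (T c)" "T c \<noteq> {}" if "c \<in> boxes lam" for c
    using that by (auto intro: finite_subset)
  have le: "Max (T c) \<le> Min (T d) \<longleftrightarrow> (\<forall>p\<in>T c. \<forall>r\<in>T d. p \<le> r)"
    and less: "Max (T c) < Min (T d) \<longleftrightarrow> (\<forall>p\<in>T c. \<forall>r\<in>T d. p < r)"
    if "c \<in> boxes lam" "d \<in> boxes lam" for c d
    using fin[OF that(1)] fin[OF that(2)] by auto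
  show ?thesis
    unfolding svt_def using True by (simp add: le less)
qed (auto simp: svt_def)

lemma svt_entries:
  assumes "T \<in> svt n lam"
  shows "c \<in> boxes lam \<Longrightarrow> T c \<noteq> {}" "c \<notin> boxes lam \<Longrightarrow> T c = {}"
    and "r \<in> T c \<Longrightarrow> 1 \<le> r \<and> r \<le> n" "finite (T c)"
proof -
  show "c \<in> boxes lam \<Longrightarrow> T c \<noteq> {}" "c \<notin> boxes lam \<Longrightarrow> T c = {}"
    using assms unfolding svt_iff by blast+
  have "c \<in> boxes lam \<Longrightarrow> T c \<subseteq> {1..n}" "c \<notin> boxes lam \<Longrightarrow> T c = {}"
    using assms unfolding svt_iff by blast+
  then have "T c \<subseteq> {1..n}"
    by (cases "c \<in> boxes lam") simp_all
  then show "r \<in> T c \<Longrightarrow> 1 \<le> r \<and> r \<le> n" "finite (T c)"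
    by (auto intro: finite_subset)
qed

lemma svt_row:
  assumes "T \<in> svt n lam" "(i, j) \<in> boxes lam" "(i, Suc j) \<in> boxes lam" "p \<in> T (i, j)" "r \<in> T (i, Suc j)"
  shows "p \<le> r"
  using assms unfolding svt_iff by blast

lemma svt_column:
  assumes "T \<in> svt n lam" "(i, j) \<in> boxes lam" "(Suc i, j) \<in> boxes lam" "p \<in> T (i, j)" "r \<in> T (Suc i, j)"
  shows "p < r"
  using assms unfolding svt_iff by blast

lemma finite_svt:
  assumes "finite (boxes lam)"
  shows "finite (svt n lam)"
proof -
  have "svt n lam \<subseteq> {T. \<forall>c. (c \<in> boxes lam \<longrightarrow> T c \<in> Pow {1..n}) \<and> (c \<notin> boxes lam \<longrightarrow> T c = {})}"
    using svt_entries(2,3) by fastforce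
  then show ?thesis
    by (rule finite_subset) (rule finite_set_of_finite_funs, use assms in auto)
qed

text \<open>Distributes the excess exponent of beta over the boxes, each of which is nonempty, so
  that the weight of a tableau becomes a product over boxes.\<close>

definition box_weight :: "'a::comm_ring_1 \<Rightarrow> (nat \<Rightarrow> 'a) \<Rightarrow> (nat \<Rightarrow> 'a) \<Rightarrow> nat \<times> nat \<Rightarrow> nat set \<Rightarrow> 'a" where
  "box_weight b x s c S =
     b ^ (card S - 1) * (\<Prod>r\<in>S. oplusB b (x r) (s (r + snd c - fst c)))"

lemma Groth_eq_sum_prod_box_weight:
  assumes "finite (boxes lam)"
  shows "Groth b n lam x s = (\<Sum>T\<in>svt n lam. \<Prod>c\<in>boxes lam. box_weight b x s c (T c))"
  unfolding Groth_def
proof (rule sum.cong[OF refl])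
  fix T assume T: "T \<in> svt n lam"
  have card: "1 \<le> card (T c)" if "c \<in> boxes lam" for c
  proof -
    show ?thesis using svt_entries[OF T] that by (simp add: Suc_le_eq card_gt_0_iff)
  qed
  have "tsize lam T - card (boxes lam) = (\<Sum>c\<in>boxes lam. card (T c) - 1)"
    using card by (simp add: tsize_def sum_subtractf_nat)
  then show "b ^ (tsize lam T - card (boxes lam)) *
      (\<Prod>(i, j)\<in>boxes lam. \<Prod>r\<in>T (i, j). oplusB b (x r) (s (r + j - i)))
      = (\<Prod>c\<in>boxes lam. box_weight b x s c (T c))"
    by (simp add: box_weight_def prod.distrib power_sum case_prod_beta)
qed

text \<open>The shapes that can remain when the boxes containing only n + 1 are removed. The
  complement is a horizontal strip, because a column holds n + 1 at most once.\<close>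

definition interlacing :: "nat \<Rightarrow> (nat \<Rightarrow> nat) \<Rightarrow> (nat \<Rightarrow> nat) set" where
  "interlacing n lam = {mu. mu 0 = 0 \<and> (\<forall>i. 1 \<le> i \<and> i \<le> n \<longrightarrow> lam (Suc i) \<le> mu i \<and> mu i \<le> lam i)
      \<and> (\<forall>i>n. mu i = 0)}"

text \<open>The boxes of mu that may hold n + 1 besides smaller letters: nothing of mu lies to the
  right, where a letter below n + 1 would follow, and nothing of lam lies below, where a letter
  above n + 1 would be required.\<close>

definition free_ends :: "(nat \<Rightarrow> nat) \<Rightarrow> (nat \<Rightarrow> nat) \<Rightarrow> (nat \<times> nat) set" where
  "free_ends lam mu = {(i, j) \<in> boxes mu. j = mu i \<and> lam (Suc i) < mu i}"

lemma finite_interlacing: "finite (interlacing n lam)"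
proof -
  have "interlacing n lam \<subseteq> {mu. \<forall>i. (i \<in> {1..n} \<longrightarrow> mu i \<in> {..Max (lam ` {1..n})})
      \<and> (i \<notin> {1..n} \<longrightarrow> mu i = 0)}"
  proof clarify
    fix mu i assume mu: "mu \<in> interlacing n lam"
    have "mu i \<le> Max (lam ` {1..n})" if i: "i \<in> {1..n}"
    proof -
      have "mu i \<le> lam i" using mu i by (simp add: interlacing_def)
      also have "\<dots> \<le> Max (lam ` {1..n})" using i by (intro Max_ge) auto
      finally show ?thesis .
    qed
    moreover have "mu i = 0" if "i \<notin> {1..n}"
      using mu that by (cases "i = 0") (auto simp: interlacing_def)
    ultimately show "(i \<in> {1..n} \<longrightarrow> mu i \<in> {..Max (lam ` {1..n})}) \<and> (i \<notin> {1..n} \<longrightarrow> mu i = 0)"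
      by auto
  qed
  then show ?thesis
    by (rule finite_subset) (rule finite_set_of_finite_funs, auto)
qed

lemma interlacing_part_box:
  assumes "part_box (Suc n) k lam" "mu \<in> interlacing n lam"
  shows "part_box n k mu"
  unfolding part_box_def
proof (intro conjI allI impI)
  show "mu 0 = 0" "\<And>i. i > n \<Longrightarrow> mu i = 0" using assms(2) by (auto simp: interlacing_def)
next
  fix i :: nat assume i: "1 \<le> i"
  show "mu (Suc i) \<le> mu i"
  proof (cases "Suc i \<le> n")
    case True
    then have "mu (Suc i) \<le> lam (Suc i)" "lam (Suc i) \<le> mu i"
      using assms(2) i by (simp_all add: interlacing_def)
    then show ?thesis by simp
  qed (use assms(2) in \<open>simp add: interlacing_def\<close>)
next
  fix i
  show "mu i \<le> k"
  proof (cases "1 \<le> i \<and> i \<le> n")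
    case True
    then have "mu i \<le> lam i" "lam i \<le> k"
      using assms by (simp_all add: interlacing_def part_box_def)
    then show ?thesis by simp
  next
    case False
    then have "mu i = 0" using assms(2) by (cases "i = 0") (auto simp: interlacing_def)
    then show ?thesis by simp
  qed
qed

section \<open>Removing and restoring the largest letter\<close>

definition attach :: "nat \<Rightarrow> (nat \<Rightarrow> nat) \<Rightarrow> (nat \<Rightarrow> nat) \<Rightarrow> (nat \<times> nat \<Rightarrow> nat set) \<Rightarrow> (nat \<times> nat) set
    \<Rightarrow> nat \<times> nat \<Rightarrow> nat set" where
  "attach n lam mu T X = (\<lambda>c. T c \<union> (if c \<in> boxes lam - boxes mu \<or> c \<in> X then {Suc n} else {}))"

text \<open>A count determines the row because the surviving boxes form an initial segment of it:
  weak increase puts boxes containing only n + 1 at the end.\<close>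

definition inner_shape :: "nat \<Rightarrow> (nat \<Rightarrow> nat) \<Rightarrow> (nat \<times> nat \<Rightarrow> nat set) \<Rightarrow> nat \<Rightarrow> nat" where
  "inner_shape n lam T = (\<lambda>i. card {j \<in> {1..lam i}. T (i, j) \<noteq> {Suc n}})"

lemma initial_segment_eq:
  fixes D :: "nat set"
  assumes "finite D" "0 \<notin> D" "\<And>j. 1 \<le> j \<Longrightarrow> Suc j \<in> D \<Longrightarrow> j \<in> D"
  shows "D = {1..card D}"
proof (cases "D = {}")
  case False
  have down: "j \<in> D" if "j \<le> m" "1 \<le> j" "m \<in> D" for j m
    using that by (induction rule: inc_induct) (auto intro: assms(3))
  have "D = {1..Max D}"
  proof (rule set_eqI)
    fix j
    have "j \<noteq> 0" if "j \<in> D" using assms(2) that by metis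
    then show "j \<in> D \<longleftrightarrow> j \<in> {1..Max D}"
      using down[of j "Max D"] Max_in[OF assms(1) False] Max_ge[OF assms(1)] by auto
  qed
  then show ?thesis by (metis card_atLeastAtMost diff_Suc_1)
qed simp

context
  fixes n k :: nat and lam :: "nat \<Rightarrow> nat"
  assumes lam: "part_box (Suc n) k lam"
begin

lemma boxes_mono:
  assumes "mu \<in> interlacing n lam" shows "boxes mu \<subseteq> boxes lam"
proof
  fix c assume "c \<in> boxes mu"
  then obtain i j where c: "c = (i, j)" "1 \<le> i" "1 \<le> j" "j \<le> mu i" by (auto simp: boxes_def)
  then have "i \<le> n" using assms by (cases "i \<le> n") (auto simp: interlacing_def)
  then have "mu i \<le> lam i" using c assms by (simp add: interlacing_def)
  then show "c \<in> boxes lam" using c by (simp add: boxes_def)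
qed

lemma attach_svt:
  assumes mu: "mu \<in> interlacing n lam" and T: "T \<in> svt n mu" and X: "X \<subseteq> free_ends lam mu"
  shows "attach n lam mu T X \<in> svt (Suc n) lam"
  unfolding svt_iff
proof (intro conjI ballI allI impI)
  have Xmu: "X \<subseteq> boxes mu" using X by (auto simp: free_ends_def)
  note entries = svt_entries[OF T]
  have le: "r \<le> n" if "r \<in> T c" for r c
    using svt_entries(3)[OF T that] by simp
  {
    fix c assume c: "c \<in> boxes lam"
    show "attach n lam mu T X c \<noteq> {}" using entries(1)[of c] c by (auto simp: attach_def)
    show "attach n lam mu T X c \<subseteq> {1..Suc n}"
    proof
      fix r assume "r \<in> attach n lam mu T X c"
      then show "r \<in> {1..Suc n}"
        using entries(3)[of r c] by (auto simp: attach_def split: if_splits)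
    qed
  next
    fix c assume "c \<notin> boxes lam"
    then show "attach n lam mu T X c = {}"
      using entries(2)[of c] boxes_mono[OF mu] Xmu by (auto simp: attach_def)
  next
    fix i j p r
    assume c: "(i, j) \<in> boxes lam \<and> (i, Suc j) \<in> boxes lam"
      and p: "p \<in> attach n lam mu T X (i, j)" and r: "r \<in> attach n lam mu T X (i, Suc j)"
    show "p \<le> r"
    proof (cases "r = Suc n")
      case True
      then show ?thesis using p le[of p] by (auto simp: attach_def split: if_splits intro: le_SucI)
    next
      case False
      then have r': "r \<in> T (i, Suc j)" using r by (auto simp: attach_def split: if_splits)
      then have sj: "(i, Suc j) \<in> boxes mu" using entries(2) by blast
      then have j: "(i, j) \<in> boxes mu" using c by (auto simp: boxes_def)
      have "(i, j) \<notin> X" using X sj by (auto simp: free_ends_def boxes_def)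
      then have "p \<in> T (i, j)" using p j by (auto simp: attach_def split: if_splits)
      then show ?thesis using svt_row[OF T j sj _ r'] by simp
    qed
  next
    fix i j p r
    assume c: "(i, j) \<in> boxes lam \<and> (Suc i, j) \<in> boxes lam"
      and p: "p \<in> attach n lam mu T X (i, j)" and r: "r \<in> attach n lam mu T X (Suc i, j)"
    have "Suc i \<le> Suc n" using c lam by (cases "Suc i \<le> Suc n") (auto simp: boxes_def part_box_def)
    then have i: "lam (Suc i) \<le> mu i" using mu c by (auto simp: interlacing_def boxes_def)
    then have j: "(i, j) \<in> boxes mu" using c by (auto simp: boxes_def)
    have "(i, j) \<notin> X" using X i c by (auto simp: free_ends_def boxes_def)
    then have p': "p \<in> T (i, j)" using p j by (auto simp: attach_def split: if_splits)
    show "p < r"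
    proof (cases "r = Suc n")
      case True
      then show ?thesis using le[OF p'] by simp
    next
      case False
      then have r': "r \<in> T (Suc i, j)" using r by (auto simp: attach_def split: if_splits)
      then have "(Suc i, j) \<in> boxes mu" using entries(2) by blast
      then show ?thesis using svt_column[OF T j _ p' r'] by simp
    qed
  }
qed

lemma boxes_inner_shape:
  assumes T: "T \<in> svt (Suc n) lam"
  shows "boxes (inner_shape n lam T) = {c \<in> boxes lam. T c \<noteq> {Suc n}}"
proof -
  have row: "{j \<in> {1..lam i}. T (i, j) \<noteq> {Suc n}} = {1..inner_shape n lam T i}" if i: "1 \<le> i" for i
    unfolding inner_shape_def
  proof (rule initial_segment_eq)
    fix j assume j: "1 \<le> j" "Suc j \<in> {j \<in> {1..lam i}. T (i, j) \<noteq> {Suc n}}"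
    have c: "(i, j) \<in> boxes lam" "(i, Suc j) \<in> boxes lam" using i j by (auto simp: boxes_def)
    have "\<exists>r\<in>T (i, Suc j). r \<noteq> Suc n" using svt_entries(1)[OF T c(2)] j(2) by auto
    then obtain r where r: "r \<in> T (i, Suc j)" "r \<le> n"
      using svt_entries(3)[OF T] le_SucE by metis
    have "T (i, j) \<noteq> {Suc n}"
    proof
      assume "T (i, j) = {Suc n}"
      then have "Suc n \<le> r" using svt_row[OF T c _ r(1)] by simp
      then show False using r(2) by simp
    qed
    then show "j \<in> {j \<in> {1..lam i}. T (i, j) \<noteq> {Suc n}}" using j by auto
  qed auto
  have "j \<le> inner_shape n lam T i \<longleftrightarrow> j \<le> lam i \<and> T (i, j) \<noteq> {Suc n}" if "1 \<le> i" "1 \<le> j" for i j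
  proof -
    have "j \<in> {j \<in> {1..lam i}. T (i, j) \<noteq> {Suc n}} \<longleftrightarrow> j \<in> {1..inner_shape n lam T i}"
      using row[OF that(1)] by simp
    then show ?thesis using that(2) by simp
  qed
  then show ?thesis by (auto simp: boxes_def)
qed

text \<open>Columns increase strictly and start at 1 or more. With n + 1 letters every box of row n
  + 1 therefore contains n + 1 alone, so the inner shape has at most n rows.\<close>

lemma svt_row_le:
  assumes T: "T \<in> svt m lam" and "(i, j) \<in> boxes lam" "r \<in> T (i, j)"
  shows "i \<le> r"
  using assms(2,3)
proof (induction i arbitrary: r)
  case (Suc i)
  show ?case
  proof (cases "i = 0")
    case True
    then show ?thesis using svt_entries(3)[OF T Suc.prems(2)] by simp
  next
    case False
    then have c: "(i, j) \<in> boxes lam"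
      using Suc.prems lam by (auto simp: boxes_def part_box_def intro: order_trans[of j])
    then obtain p where p: "p \<in> T (i, j)" using svt_entries(1)[OF T] by blast
    then have "p < r" using svt_column[OF T c] Suc.prems by blast
    then show ?thesis using Suc.IH[OF c p] by simp
  qed
qed simp

lemma inner_shape_interlacing:
  assumes T: "T \<in> svt (Suc n) lam"
  shows "inner_shape n lam T \<in> interlacing n lam"
  unfolding interlacing_def
proof safe
  show "inner_shape n lam T 0 = 0"
    using lam by (simp add: inner_shape_def part_box_def)
  fix i
  show "inner_shape n lam T i \<le> lam i"
    unfolding inner_shape_def by (rule order_trans[OF card_mono[of "{1..lam i}"]]) auto
  {
    assume i: "1 \<le> i" "i \<le> n"
    show "lam (Suc i) \<le> inner_shape n lam T i"
    proof (cases "lam (Suc i) = 0")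
      case False
      define j where "j = lam (Suc i)"
      have "lam (Suc i) \<le> lam i" using lam i by (simp add: part_box_def)
      then have c: "(i, j) \<in> boxes lam" "(Suc i, j) \<in> boxes lam"
        using False i by (auto simp: boxes_def j_def)
      obtain r where r: "r \<in> T (Suc i, j)" "r \<le> Suc n"
        using svt_entries(1,3)[OF T] c(2) by blast
      have "T (i, j) \<noteq> {Suc n}"
      proof
        assume "T (i, j) = {Suc n}"
        then have "Suc n < r" using svt_column[OF T c _ r(1)] by simp
        then show False using r(2) by simp
      qed
      then have "(i, j) \<in> boxes (inner_shape n lam T)"
        using c boxes_inner_shape[OF T] by simp
      then show ?thesis by (simp add: boxes_def j_def)
    qed simp
  next
    assume i: "n < i"
    have "T (i, j) = {Suc n}" if j: "j \<in> {1..lam i}" for j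
    proof -
      have c: "(i, j) \<in> boxes lam" using j i by (auto simp: boxes_def)
      have "r = Suc n" if "r \<in> T (i, j)" for r
        using svt_row_le[OF T c that] svt_entries(3)[OF T that] i by simp
      then show ?thesis using svt_entries(1)[OF T c] by auto
    qed
    then show "inner_shape n lam T i = 0" by (simp add: inner_shape_def)
  }
qed

lemma detach_svt:
  assumes T: "T \<in> svt (Suc n) lam"
  shows "(\<lambda>c. T c - {Suc n}) \<in> svt n (inner_shape n lam T)"
    and "{c \<in> boxes (inner_shape n lam T). Suc n \<in> T c} \<subseteq> free_ends lam (inner_shape n lam T)"
proof -
  note boxes = boxes_inner_shape[OF T]
  note entries = svt_entries[OF T]

  show "(\<lambda>c. T c - {Suc n}) \<in> svt n (inner_shape n lam T)"
    unfolding svt_iff boxes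
  proof (intro conjI ballI allI impI)
    fix c assume c: "c \<in> {c \<in> boxes lam. T c \<noteq> {Suc n}}"
    show "T c - {Suc n} \<noteq> {}" using entries(1)[of c] c by auto
    show "T c - {Suc n} \<subseteq> {1..n}"
    proof
      fix r assume "r \<in> T c - {Suc n}"
      then show "r \<in> {1..n}" using entries(3)[of r c] by auto
    qed
  next
    fix c assume "c \<notin> {c \<in> boxes lam. T c \<noteq> {Suc n}}"
    then show "T c - {Suc n} = {}" using entries(2)[of c] by auto
  qed (use svt_row[OF T] svt_column[OF T] in blast)+
  show "{c \<in> boxes (inner_shape n lam T). Suc n \<in> T c} \<subseteq> free_ends lam (inner_shape n lam T)"
  proof safe
    fix i j assume c: "(i, j) \<in> boxes (inner_shape n lam T)" and top: "Suc n \<in> T (i, j)"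
    have c': "(i, j) \<in> boxes lam" using c boxes by auto
    have "\<not> j < inner_shape n lam T i"
    proof
      assume "j < inner_shape n lam T i"
      then have "(i, Suc j) \<in> boxes (inner_shape n lam T)" using c by (auto simp: boxes_def)
      then have d: "(i, Suc j) \<in> boxes lam" "T (i, Suc j) \<noteq> {Suc n}" using boxes by auto
      have "r = Suc n" if "r \<in> T (i, Suc j)" for r
        using svt_row[OF T c' d(1) top that] entries(3)[OF that] by simp
      then show False using d(2) entries(1)[OF d(1)] by auto
    qed
    then have j: "j = inner_shape n lam T i" using c by (auto simp: boxes_def)
    have "\<not> lam (Suc i) \<ge> inner_shape n lam T i"
    proof
      assume "lam (Suc i) \<ge> inner_shape n lam T i"
      then have d: "(Suc i, j) \<in> boxes lam" using c j by (auto simp: boxes_def)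
      then obtain r where r: "r \<in> T (Suc i, j)" using entries(1) by blast
      show False using svt_column[OF T c' d top r] entries(3)[OF r] by simp
    qed
    then show "(i, j) \<in> free_ends lam (inner_shape n lam T)"
      using c j by (simp add: free_ends_def)
  qed
qed

end

lemma boxes_inject:
  assumes "boxes lam = boxes mu" "lam 0 = 0" "mu 0 = 0" shows "lam = mu"
proof
  fix i
  show "lam i = mu i"
  proof (cases "i = 0")
    case False
    have "j \<le> lam i \<longleftrightarrow> j \<le> mu i" if "1 \<le> j" for j
    proof -
      have "(i, j) \<in> boxes lam \<longleftrightarrow> (i, j) \<in> boxes mu" using assms(1) by simp
      then show ?thesis using that False by (simp add: boxes_def)
    qed
    from this[of "lam i"] this[of "mu i"] show ?thesis
      by (metis One_nat_def Suc_leI le_antisym neq0_conv order_refl le_zero_eq)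
  qed (use assms in simp)
qed

text \<open>For a fixed inner shape, the boxes outside it contain n + 1 alone and contribute u. At
  each free end n + 1 may be added independently at the price b u, and the sum over subsets of the
  free ends is the product of the factors 1 + b u.\<close>

lemma Groth_branching:
  fixes b :: "'a::comm_ring_1" and x s :: "nat \<Rightarrow> 'a"
  assumes lam: "part_box (Suc n) k lam"
  defines "u \<equiv> \<lambda>c. oplusB b (x (Suc n)) (s (Suc n + snd c - fst c))"
  shows "Groth b (Suc n) lam x s = (\<Sum>mu\<in>interlacing n lam.
     (\<Prod>c\<in>boxes lam - boxes mu. u c) * (\<Prod>c\<in>free_ends lam mu. 1 + b * u c) * Groth b n mu x s)"
proof -
  define w where "w = box_weight b x s"
  have fin: "finite (boxes lam)"
    using lam by (intro finite_boxes[of "Suc n"]) (simp add: part_box_def)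
  have fin_mu: "finite (boxes mu)" if "mu \<in> interlacing n lam" for mu
    using boxes_mono[OF lam that] fin by (rule finite_subset)
  have fin_free: "finite (free_ends lam mu)" if "mu \<in> interlacing n lam" for mu
    by (rule finite_subset[OF _ fin_mu[OF that]]) (auto simp: free_ends_def)
  have "Groth b (Suc n) lam x s = (\<Sum>T\<in>svt (Suc n) lam. \<Prod>c\<in>boxes lam. w c (T c))"
    unfolding w_def by (rule Groth_eq_sum_prod_box_weight[OF fin])
  also have "\<dots> = (\<Sum>(mu, T, X)\<in>Sigma (interlacing n lam) (\<lambda>mu. svt n mu \<times> Pow (free_ends lam mu)).
      (\<Prod>c\<in>boxes lam - boxes mu. u c) * (\<Prod>c\<in>X. b * u c) * (\<Prod>c\<in>boxes mu. w c (T c)))"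
  proof (rule sum.reindex_bij_witness[of _
      "\<lambda>(mu, T, X). attach n lam mu T X"
      "\<lambda>T. (inner_shape n lam T, \<lambda>c. T c - {Suc n}, {c \<in> boxes (inner_shape n lam T). Suc n \<in> T c})"], goal_cases)
    case (1 T)
    show ?case
    proof (simp, rule ext)
      fix c
      show "attach n lam (inner_shape n lam T) (\<lambda>c. T c - {Suc n})
          {c \<in> boxes (inner_shape n lam T). Suc n \<in> T c} c = T c"
        using svt_entries(2)[OF 1, of c] unfolding attach_def boxes_inner_shape[OF lam 1] by auto
    qed
  next
    case (2 T)
    show ?case
      using inner_shape_interlacing[OF lam 2] detach_svt[OF lam 2] by simp
  next
    case (3 a)
    then obtain mu T X where a: "a = (mu, T, X)" and mu: "mu \<in> interlacing n lam"
      and T: "T \<in> svt n mu" and X: "X \<subseteq> free_ends lam mu" by auto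
    define T' where "T' = attach n lam mu T X"
    have T': "T' \<in> svt (Suc n) lam" unfolding T'_def by (rule attach_svt[OF lam mu T X])
    have Xmu: "X \<subseteq> boxes mu" using X by (auto simp: free_ends_def)
    have Tn: "Suc n \<notin> T c" for c using svt_entries(3)[OF T] by fastforce
    have "T' c \<noteq> {Suc n} \<longleftrightarrow> c \<in> boxes mu" if "c \<in> boxes lam" for c
      using that svt_entries(1,2)[OF T, of c] Tn[of c] Xmu by (auto simp: T'_def attach_def)
    then have "boxes (inner_shape n lam T') = boxes mu"
      unfolding boxes_inner_shape[OF lam T'] using boxes_mono[OF lam mu] by auto
    then have shape: "inner_shape n lam T' = mu"
      by (rule boxes_inject) (use mu inner_shape_interlacing[OF lam T'] in \<open>auto simp: interlacing_def\<close>)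
    have "T' c - {Suc n} = T c" for c
      using Tn[of c] by (auto simp: T'_def attach_def)
    moreover have "{c \<in> boxes mu. Suc n \<in> T' c} = X"
      using Tn Xmu by (auto simp: T'_def attach_def)
    ultimately show ?case
      by (simp add: a T'_def[symmetric] shape)
  next
    case (4 a)
    then show ?case using attach_svt[OF lam] by auto
  next
    case (5 T)
    define mu where "mu = inner_shape n lam T"
    have boxes: "boxes mu = {c \<in> boxes lam. T c \<noteq> {Suc n}}"
      unfolding mu_def by (rule boxes_inner_shape[OF lam 5])
    have T: "finite (T c)" for c
      using svt_entries(4)[OF 5] .
    have "(\<Prod>c\<in>boxes lam. w c (T c)) = (\<Prod>c\<in>boxes lam - boxes mu. w c (T c)) * (\<Prod>c\<in>boxes mu. w c (T c))"
      using fin boxes by (intro prod.subset_diff) auto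
    also have "(\<Prod>c\<in>boxes lam - boxes mu. w c (T c)) = (\<Prod>c\<in>boxes lam - boxes mu. u c)"
      by (rule prod.cong) (auto simp: boxes w_def u_def box_weight_def)
    also have "(\<Prod>c\<in>boxes mu. w c (T c)) =
        (\<Prod>c\<in>boxes mu. (if Suc n \<in> T c then b * u c else 1) * w c (T c - {Suc n}))"
    proof (rule prod.cong[OF refl])
      fix c assume c: "c \<in> boxes mu"
      show "w c (T c) = (if Suc n \<in> T c then b * u c else 1) * w c (T c - {Suc n})"
      proof (cases "Suc n \<in> T c")
        case True
        have "T c - {Suc n} \<noteq> {}" using True c boxes by auto
        \<comment> \<open>A smaller letter remains in the box, so the truncated exponent card - 1
          drops by exactly one; this is the b in b u.\<close>
        then have "0 < card (T c - {Suc n})" using T c boxes by (auto simp: card_gt_0_iff)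
        moreover have "card (T c) = Suc (card (T c - {Suc n}))"
          using True T c boxes by (intro card.remove) auto
        ultimately have "b ^ (card (T c) - 1) = b * b ^ (card (T c - {Suc n}) - 1)"
          by (cases "card (T c - {Suc n})") auto
        moreover have "(\<Prod>r\<in>T c. oplusB b (x r) (s (r + snd c - fst c))) =
            u c * (\<Prod>r\<in>T c - {Suc n}. oplusB b (x r) (s (r + snd c - fst c)))"
          unfolding u_def using True T c boxes by (intro prod.remove) auto
        ultimately show ?thesis using True by (simp add: w_def box_weight_def mult_ac)
      qed simp
    qed
    also have "\<dots> = (\<Prod>c\<in>{c \<in> boxes mu. Suc n \<in> T c}. b * u c) * (\<Prod>c\<in>boxes mu. w c (T c - {Suc n}))"
      using fin boxes by (simp add: prod.distrib prod.If_cases Int_def)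
    finally show ?case by (simp only: mu_def mult.assoc split)
  qed
  also have "\<dots> = (\<Sum>mu\<in>interlacing n lam. \<Sum>T\<in>svt n mu. \<Sum>X\<in>Pow (free_ends lam mu).
      (\<Prod>c\<in>boxes lam - boxes mu. u c) * (\<Prod>c\<in>X. b * u c) * (\<Prod>c\<in>boxes mu. w c (T c)))"
  proof -
    have "\<forall>mu\<in>interlacing n lam. finite (svt n mu \<times> Pow (free_ends lam mu))"
      using fin_mu fin_free finite_svt by blast
    from sum.Sigma[OF finite_interlacing this, symmetric]
    show ?thesis by (simp only: sum.cartesian_product)
  qed
  also have "\<dots> = (\<Sum>mu\<in>interlacing n lam.
     (\<Prod>c\<in>boxes lam - boxes mu. u c) * (\<Prod>c\<in>free_ends lam mu. 1 + b * u c) * Groth b n mu x s)"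
  proof (rule sum.cong[OF refl])
    fix mu assume mu: "mu \<in> interlacing n lam"
    have "(\<Prod>c\<in>free_ends lam mu. 1 + b * u c) = (\<Sum>X\<in>Pow (free_ends lam mu). \<Prod>c\<in>X. b * u c)"
      using prod_add[OF fin_free[OF mu], of "\<lambda>c. b * u c" "\<lambda>c. 1"] by (simp add: add.commute)
    then show "(\<Sum>T\<in>svt n mu. \<Sum>X\<in>Pow (free_ends lam mu).
      (\<Prod>c\<in>boxes lam - boxes mu. u c) * (\<Prod>c\<in>X. b * u c) * (\<Prod>c\<in>boxes mu. w c (T c)))
      = (\<Prod>c\<in>boxes lam - boxes mu. u c) * (\<Prod>c\<in>free_ends lam mu. 1 + b * u c) * Groth b n mu x s"
      unfolding Groth_eq_sum_prod_box_weight[OF fin_mu[OF mu]] w_def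
      by (subst sum.swap) (simp add: sum_distrib_left sum_distrib_right mult_ac)
  qed
  finally show ?thesis .
qed

section \<open>Partitions and their index sets\<close>

text \<open>Indexing by the row of the partition lists the elements in decreasing order, which lets
  interlacing be compared row by row.\<close>

lemma Iset_eq_image: "Iset n lam = (\<lambda>i. lam i + (n + 1 - i)) ` {1..n}"
proof safe
  fix m assume "m \<in> Iset n lam"
  then obtain i where i: "m = lam (n + 1 - i) + i" "1 \<le> i" "i \<le> n" by (auto simp: Iset_def)
  then have "m = lam (n + 1 - i) + (n + 1 - (n + 1 - i))" "n + 1 - i \<in> {1..n}" by auto
  then show "m \<in> (\<lambda>i. lam i + (n + 1 - i)) ` {1..n}" by blast
next
  fix i assume i: "i \<in> {1..n}"
  then have "lam i + (n + 1 - i) = lam (n + 1 - (n + 1 - i)) + (n + 1 - i)" by simp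
  then show "lam i + (n + 1 - i) \<in> Iset n lam"
    unfolding Iset_def using i by (intro CollectI exI[of _ "n + 1 - i"]) auto
qed

lemma part_box_antimono:
  assumes "part_box n k lam" "1 \<le> i" "i \<le> i'" shows "lam i' \<le> lam i"
  using assms(3,2)
proof (induction rule: dec_induct)
  case (step m)
  then have "lam (Suc m) \<le> lam m" using assms(1) by (simp add: part_box_def)
  then show ?case using step by simp
qed simp

lemma Iset_elements_strict_antimono:
  assumes "part_box n k lam" "1 \<le> i" "i < i'" "i' \<le> n + 1"
  shows "lam i' + (n + 1 - i') < lam i + (n + 1 - i)"
  using part_box_antimono[OF assms(1,2), of i'] assms by simp

lemma inj_on_Iset_elements:
  assumes "part_box n k lam" shows "inj_on (\<lambda>i. lam i + (n + 1 - i)) {1..n}"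
proof (rule linorder_inj_onI')
  fix i i' assume "i \<in> {1..n}" "i' \<in> {1..n}" "i < i'"
  then show "lam i + (n + 1 - i) \<noteq> lam i' + (n + 1 - i')"
    using Iset_elements_strict_antimono[OF assms, of i i'] by simp
qed

lemma card_Iset: "part_box n k lam \<Longrightarrow> card (Iset n lam) = n"
  by (simp only: Iset_eq_image card_image[OF inj_on_Iset_elements]) simp

lemma Iset_subset: "part_box n k lam \<Longrightarrow> Iset n lam \<subseteq> {1..n + k}"
proof (clarsimp simp: Iset_eq_image)
  fix i assume "part_box n k lam" and i: "Suc 0 \<le> i" "i \<le> n"
  then have "lam i \<le> k" by (simp add: part_box_def)
  then show "Suc 0 \<le> Suc (lam i + n) - i \<and> Suc (lam i + n) - i \<le> n + k" using i by linarith
qed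

lemma finite_Iset: "finite (Iset n lam)"
  by (simp add: Iset_eq_image)

lemma part_of_set:
  assumes I: "I \<subseteq> {1..n + k}" "card I = n"
  shows "part_box n k (part_of_set n I)" "Iset n (part_of_set n I) = I"
proof -
  define L where "L = sorted_list_of_set I"
  have fin: "finite I" using I(1) by (rule finite_subset) simp
  have L: "length L = n" "set L = I" "sorted_wrt (<) L"
    using fin I(2) by (simp_all add: L_def strict_sorted_iff)
  have step: "L ! i < L ! i'" if "i < i'" "i' < n" for i i'
    using L(1,3) that by (simp add: sorted_wrt_nth_less)
  have range: "1 \<le> L ! m" "L ! m \<le> n + k" if "m < n" for m
  proof -
    have "L ! m \<in> I" using L(1,2) that nth_mem by metis
    then show "1 \<le> L ! m" "L ! m \<le> n + k" using I(1) by auto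
  qed
  \<comment> \<open>Makes the truncated subtraction in \<open>part_of_set\<close> exact.\<close>
  have lower: "Suc m \<le> L ! m" if "m < n" for m
    using that
  proof (induction m)
    case 0 then show ?case using range[of 0] by simp
  next
    case (Suc m) then show ?case using step[of m "Suc m"] by simp
  qed
  \<comment> \<open>The same count from the top end; it bounds the parts by k.\<close>
  have upper: "L ! (n - Suc m) + m \<le> n + k" if "m < n" for m
    using that
  proof (induction m)
    case 0 then show ?case using range[of "n - 1"] by simp
  next
    case (Suc m)
    have "n - Suc (Suc m) < n - Suc m" "n - Suc m < n" using Suc.prems by auto
    then show ?case using step[of "n - Suc (Suc m)" "n - Suc m"] Suc by simp
  qed
  have P: "part_of_set n I r = L ! (n - r) - (n + 1 - r)" if "1 \<le> r" "r \<le> n" for r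
    using that by (simp add: part_of_set_def L_def)
  have P0: "part_of_set n I r = 0" if "\<not> (1 \<le> r \<and> r \<le> n)" for r
    unfolding part_of_set_def using that by (rule if_not_P)
  show "part_box n k (part_of_set n I)"
    unfolding part_box_def
  proof (intro conjI allI impI)
    show "part_of_set n I 0 = 0" "\<And>r. n < r \<Longrightarrow> part_of_set n I r = 0"
      by (simp_all add: P0)
    fix r
    show "part_of_set n I r \<le> k"
    proof (cases "1 \<le> r \<and> r \<le> n")
      case True
      then show ?thesis using upper[of "r - 1"] P[of r] by (cases r) auto
    next
      case False
      then show ?thesis using P0 by simp
    qed
    assume r: "1 \<le> r"
    show "part_of_set n I (Suc r) \<le> part_of_set n I r"
    proof (cases "Suc r \<le> n")
      case True
      then have "n - Suc r < n - r" "n - r < n" using r by auto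
      then have "L ! (n - Suc r) < L ! (n - r)" by (rule step)
      then show ?thesis using True r P[of r] P[of "Suc r"] by linarith
    qed (simp add: P0)
  qed
  have "Iset n (part_of_set n I) = (\<lambda>i. L ! (n - i)) ` {1..n}"
    unfolding Iset_eq_image
  proof (rule image_cong[OF refl])
    fix i assume "i \<in> {1..n}"
    then show "part_of_set n I i + (n + 1 - i) = L ! (n - i)"
      using P[of i] lower[of "n - i"] by auto
  qed
  also have "\<dots> = (\<lambda>i. L ! i) ` {..<n}"
  proof -
    have "(\<lambda>i. n - i) ` {1..n} = {..<n}"
    proof safe
      fix i assume "i < n"
      then have "i = n - (n - i)" "n - i \<in> {1..n}" by auto
      then show "i \<in> (\<lambda>i. n - i) ` {1..n}" by blast
    qed auto
    then show ?thesis by (metis image_image)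
  qed
  also have "\<dots> = I" using L(1,2) by (auto simp: set_conv_nth)
  finally show "Iset n (part_of_set n I) = I" .
qed

text \<open>The shifted part lam i + (n + 1 - i) is the i-th largest element of the set, and an
  element is determined by its rank.\<close>

lemma Iset_inject:
  assumes "part_box n k lam" "part_box n k mu" "Iset n lam = Iset n mu"
  shows "lam = mu"
proof -
  have rank: "{m \<in> Iset n lam. lam i + (n + 1 - i) \<le> m} = (\<lambda>i. lam i + (n + 1 - i)) ` {1..i}"
      "card {m \<in> Iset n lam. lam i + (n + 1 - i) \<le> m} = i"
    if lam: "part_box n k lam" and i: "1 \<le> i" "i \<le> n" for lam i
  proof -
    have "lam i + (n + 1 - i) \<le> lam i' + (n + 1 - i') \<longleftrightarrow> i' \<le> i" if "1 \<le> i'" "i' \<le> n" for i'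
      using Iset_elements_strict_antimono[OF lam, of i i'] Iset_elements_strict_antimono[OF lam, of i' i]
        that i by (cases i i' rule: linorder_cases) auto
    then show eq: "{m \<in> Iset n lam. lam i + (n + 1 - i) \<le> m} = (\<lambda>i. lam i + (n + 1 - i)) ` {1..i}"
      unfolding Iset_eq_image using i by auto
    have "inj_on (\<lambda>i. lam i + (n + 1 - i)) {1..i}"
      by (rule inj_on_subset[OF inj_on_Iset_elements[OF lam]]) (use i in auto)
    then show "card {m \<in> Iset n lam. lam i + (n + 1 - i) \<le> m} = i"
      unfolding eq by (simp only: card_image) simp
  qed
  have not_less: "\<not> lam i < mu i" if "part_box n k lam" "part_box n k mu" "Iset n lam = Iset n mu"
    and i: "1 \<le> i" "i \<le> n" for lam mu i
  proof
    assume less: "lam i < mu i"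
    have "lam i + (n + 1 - i) \<in> Iset n mu" using that(3) i unfolding Iset_eq_image by auto
    then have "{m \<in> Iset n mu. mu i + (n + 1 - i) \<le> m} \<subset> {m \<in> Iset n lam. lam i + (n + 1 - i) \<le> m}"
    proof (intro psubsetI)
      show "{m \<in> Iset n mu. mu i + (n + 1 - i) \<le> m} \<subseteq> {m \<in> Iset n lam. lam i + (n + 1 - i) \<le> m}"
        using that(3) less by auto
      have "lam i + (n + 1 - i) \<in> {m \<in> Iset n lam. lam i + (n + 1 - i) \<le> m}"
        using \<open>lam i + (n + 1 - i) \<in> Iset n mu\<close> that(3) by simp
      moreover have "lam i + (n + 1 - i) \<notin> {m \<in> Iset n mu. mu i + (n + 1 - i) \<le> m}"
        using less by simp
      ultimately show "{m \<in> Iset n mu. mu i + (n + 1 - i) \<le> m} \<noteq> {m \<in> Iset n lam. lam i + (n + 1 - i) \<le> m}"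
        by blast
    qed
    then have "card {m \<in> Iset n mu. mu i + (n + 1 - i) \<le> m} < card {m \<in> Iset n lam. lam i + (n + 1 - i) \<le> m}"
      by (intro psubset_card_mono) (simp_all add: finite_Iset)
    then show False using rank(2)[OF that(1) i] rank(2)[OF that(2) i] by simp
  qed
  show ?thesis
  proof
    fix i
    show "lam i = mu i"
    proof (cases "1 \<le> i \<and> i \<le> n")
      case True
      then show ?thesis using not_less[OF assms] not_less[OF assms(2,1) assms(3)[symmetric]]
        by (metis linorder_neqE_nat)
    next
      case False
      then show ?thesis using assms(1,2) by (cases "i = 0") (auto simp: part_box_def)
    qed
  qed
qed

text \<open>One lattice row as a pattern a 1 > c 1 >= a 2 > c 2 >= ... >= a m > c m = 0, with a the
  exits below and c the entries from above. The sentinel c m = 0 is the left boundary: m - 1 paths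
  arrive from above and one from the left. The shifts by n + 2 - i for lam and n + 1 - i for mu turn
  the inequalities of interlacing partitions into this pattern.\<close>

locale strict_interlacing =
  fixes m P :: nat and a c :: "nat \<Rightarrow> nat"
  assumes last: "c m = 0" and less: "\<And>i. 1 \<le> i \<Longrightarrow> i \<le> m \<Longrightarrow> c i < a i"
    and le: "\<And>i. 1 \<le> i \<Longrightarrow> i < m \<Longrightarrow> a (Suc i) \<le> c i" and m: "1 \<le> m" and bound: "a 1 \<le> P"
begin

definition I where "I = a ` {1..m}"
definition J where "J = c ` {1..<m}"

lemma separated: "1 \<le> i \<Longrightarrow> i < i' \<Longrightarrow> i' \<le> m \<Longrightarrow> a i' \<le> c i"
proof (induction i' rule: nat_induct)
  case (Suc i')
  show ?case
  proof (cases "i = i'")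
    case False
    then have "a i' \<le> c i" "c i' < a i'" "a (Suc i') \<le> c i'" using Suc less[of i'] le[of i'] by auto
    then show ?thesis by simp
  qed (use Suc le in auto)
qed simp

text \<open>The i-th path runs along the row from column c i to column a i. If a (Suc i) = c i, one
  path leaves in the column where the other arrives, and the edges on both sides are
  occupied.\<close>

lemma edge_iff: "edge J I p \<longleftrightarrow> (\<exists>i\<in>{1..m}. c i \<le> p \<and> p < a i)"
proof (induction p)
  case 0
  have "c m \<le> 0 \<and> 0 < a m" using last less[of m] m by simp
  then show ?case using m by auto
next
  case (Suc p)
  have J: "Suc p \<in> J \<longleftrightarrow> (\<exists>i\<in>{1..m}. c i = Suc p)"
  proof -
    have "{1..m} = insert m {1..<m}" using m by auto
    then have "Suc p \<in> J \<longleftrightarrow> Suc p \<in> c ` {1..m}" by (simp add: J_def last)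
    then show ?thesis by force
  qed
  show ?case
  proof (cases "edge J I p")
    case True
    then obtain i where i: "1 \<le> i" "i \<le> m" "c i \<le> p" "p < a i" using Suc.IH by auto
    show ?thesis
    proof (cases "Suc p = a i")
      case True
      then have "Suc p \<in> I" using i unfolding I_def by simp
      have eq: "c i' = Suc p" if i': "1 \<le> i'" "i' \<le> m" "c i' \<le> Suc p" "Suc p < a i'" for i'
        using separated[of i i'] separated[of i' i] less[of i] less[of i'] i i' True
        by (cases i i' rule: linorder_cases) auto
      have less': "Suc p < a i'" if "1 \<le> i'" "i' \<le> m" "c i' = Suc p" for i'
        using less[of i'] that by simp
      have "edge J I (Suc p) \<longleftrightarrow> Suc p \<in> J" using \<open>edge J I p\<close> \<open>Suc p \<in> I\<close> by simp
      also have "\<dots> \<longleftrightarrow> (\<exists>i\<in>{1..m}. c i \<le> Suc p \<and> Suc p < a i)"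
        unfolding J by (rule bex_cong[OF refl]) (use eq less' in auto)
      finally show ?thesis .
    next
      case False
      have "a i' \<noteq> Suc p" if "1 \<le> i'" "i' \<le> m" for i'
        using separated[of i i'] separated[of i' i] less[of i'] less[of i] i that False
        by (cases i i' rule: linorder_cases) auto
      then have "Suc p \<notin> I" unfolding I_def by (metis atLeastAtMost_iff imageE)
      moreover have "\<exists>i\<in>{1..m}. c i \<le> Suc p \<and> Suc p < a i" using i False by (intro bexI[of _ i]) auto
      ultimately show ?thesis using \<open>edge J I p\<close> by simp
    qed
  next
    case False
    have eq: "c i = Suc p" if "1 \<le> i" "i \<le> m" "c i \<le> Suc p" "Suc p < a i" for i
    proof (rule ccontr)
      assume "c i \<noteq> Suc p"
      then have "c i \<le> p \<and> p < a i" "i \<in> {1..m}" using that by auto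
      then show False using False Suc.IH by blast
    qed
    have less': "Suc p < a i" if "1 \<le> i" "i \<le> m" "c i = Suc p" for i
      using less[of i] that by simp
    have "edge J I (Suc p) \<longleftrightarrow> Suc p \<in> J" using False by simp
    also have "\<dots> \<longleftrightarrow> (\<exists>i\<in>{1..m}. c i \<le> Suc p \<and> Suc p < a i)"
      unfolding J by (rule bex_cong[OF refl]) (use eq less' in auto)
    finally show ?thesis .
  qed
qed

lemma edge_before_a: "i \<in> {1..m} \<Longrightarrow> edge J I (a i - 1)"
  unfolding edge_iff using less[of i] by (intro bexI[of _ i]) auto

lemma a_bound: "i \<in> {1..m} \<Longrightarrow> a i \<le> P"
  using separated[of 1 i] less[of 1] bound by (cases "i = 1") auto

lemma not_edge_last: "\<not> edge J I P"
  using a_bound unfolding edge_iff by fastforce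

text \<open>Columns strictly between c i and a i are crossed horizontally and give u. A path
  arriving from above gives 1 + b u if the edge to the left is empty, that is if a (Suc i) < c i;
  for a (Suc i) = c i it meets another path and the weight is 1.\<close>

lemma row_weight_eq:
  "row_weight b x J I s P =
     (\<Prod>i\<in>{1..m}. \<Prod>p\<in>{c i<..<a i}. oplusB b x (s p)) *
     (\<Prod>i\<in>{i \<in> {1..<m}. a (Suc i) < c i}. 1 + b * oplusB b x (s (c i)))"
proof -
  define u where "u = (\<lambda>p. oplusB b x (s p))"
  define A where "A = (\<Union>i\<in>{1..m}. {c i<..<a i})"
  define B where "B = c ` {i \<in> {1..<m}. a (Suc i) < c i}"
  have AI: "p \<notin> I" and AJ: "p \<notin> J" and Ae: "edge J I (p - 1)" if pA: "p \<in> A" for p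
  proof -
    obtain i where i: "1 \<le> i" "i \<le> m" "c i < p" "p < a i" using pA by (auto simp: A_def)
    have "a i' \<noteq> p" "c i' \<noteq> p" if "1 \<le> i'" "i' \<le> m" for i'
      using separated[of i i'] separated[of i' i] less[of i'] less[of i] i that
      by (cases i i' rule: linorder_cases; auto)+
    then show "p \<notin> I" "p \<notin> J" unfolding I_def J_def by fastforce+
    show "edge J I (p - 1)" unfolding edge_iff using i by (intro bexI[of _ i]) auto
  qed
  have BJ: "p \<in> J" and Be: "\<not> edge J I (p - 1)" if pB: "p \<in> B" for p
  proof -
    obtain i where i: "1 \<le> i" "i < m" "a (Suc i) < c i" "p = c i" using pB by (auto simp: B_def)
    show "p \<in> J" using i by (auto simp: J_def)
    have "\<not> (c i' \<le> p - 1 \<and> p - 1 < a i')" if i': "1 \<le> i'" "i' \<le> m" for i'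
    proof (cases "i' \<le> i")
      case True
      then have "c i \<le> c i'" using separated[of i' i] less[of i] i i' by (cases "i = i'") auto
      then show ?thesis using i by auto
    next
      case False
      then have "a i' \<le> a (Suc i)"
        using separated[of "Suc i" i'] less[of "Suc i"] i i' by (cases "i' = Suc i") auto
      then show ?thesis using i by auto
    qed
    then show "\<not> edge J I (p - 1)" unfolding edge_iff by auto
  qed
  have vertex: "vertex b (u p) (edge J I (p - 1)) (p \<in> J) (p \<in> I) =
      (if p \<in> A then u p else 1) * (if p \<in> B then 1 + b * u p else 1)" if p: "p \<in> {1..P}" for p
  proof (cases "p \<in> I")
    case True
    then have "edge J I (p - 1)" using edge_before_a by (auto simp: I_def)
    moreover from this have "p \<notin> A" "p \<notin> B" using AI Be True by blast+
    ultimately show ?thesis using True by (simp add: vertex_def)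
  next
    case nI: False
    show ?thesis
    proof (cases "edge J I (p - 1)")
      case True
      then obtain i where i: "1 \<le> i" "i \<le> m" "c i \<le> p - 1" "p - 1 < a i" unfolding edge_iff by auto
      have "a i \<noteq> p" using nI i by (auto simp: I_def)
      then have "p \<in> {c i<..<a i}" using i p by auto
      then have "p \<in> A" using i by (auto simp: A_def)
      then show ?thesis using AI AJ Ae Be by (auto simp: vertex_def)
    next
      case nE: False
      show ?thesis
      proof (cases "p \<in> J")
        case True
        then obtain i where i: "1 \<le> i" "i < m" "c i = p" by (auto simp: J_def)
        have "\<not> (c (Suc i) \<le> p - 1 \<and> p - 1 < a (Suc i))" using nE i unfolding edge_iff by auto
        moreover have "a (Suc i) \<le> c i" "c (Suc i) < a (Suc i)" using le[of i] less[of "Suc i"] i by auto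
        ultimately have "a (Suc i) < c i" using i p by auto
        then have "p \<in> B" using i by (auto simp: B_def)
        then show ?thesis using nE nI True Ae by (auto simp: vertex_def)
      next
        case False
        then show ?thesis using nE nI Ae BJ by (auto simp: vertex_def)
      qed
    qed
  qed
  have subA: "A \<subseteq> {1..P}" using a_bound by (fastforce simp: A_def)
  have subB: "B \<subseteq> {1..P}"
  proof
    fix p assume "p \<in> B"
    then obtain i where i: "1 \<le> i" "i < m" "a (Suc i) < c i" "p = c i" by (auto simp: B_def)
    then have "c i < a i" "a i \<le> P" using less[of i] a_bound[of i] by auto
    then show "p \<in> {1..P}" using i by auto
  qed
  have "row_weight b x J I s P =
      (\<Prod>p\<in>{1..P}. (if p \<in> A then u p else 1) * (if p \<in> B then 1 + b * u p else 1))"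
    unfolding row_weight_def u_def[symmetric] by (rule prod.cong[OF refl]) (use vertex u_def in simp)
  also have "\<dots> = (\<Prod>p\<in>A. u p) * (\<Prod>p\<in>B. 1 + b * u p)"
    using subA subB by (simp add: prod.distrib prod.If_cases Int_absorb1 Int_absorb2 Int_def[symmetric])
  also have "(\<Prod>p\<in>A. u p) = (\<Prod>i\<in>{1..m}. \<Prod>p\<in>{c i<..<a i}. u p)"
    unfolding A_def
  proof (rule prod.UNION_disjoint)
    show "\<forall>i\<in>{1..m}. \<forall>i'\<in>{1..m}. i \<noteq> i' \<longrightarrow> {c i<..<a i} \<inter> {c i'<..<a i'} = {}"
    proof (intro ballI impI)
      fix i i' assume ii: "i \<in> {1..m}" "i' \<in> {1..m}" "i \<noteq> i'"
      then show "{c i<..<a i} \<inter> {c i'<..<a i'} = {}"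
        using separated[of i i'] separated[of i' i] by (cases i i' rule: linorder_cases) auto
    qed
  qed auto
  also have "(\<Prod>p\<in>B. 1 + b * u p) = (\<Prod>i\<in>{i \<in> {1..<m}. a (Suc i) < c i}. 1 + b * u (c i))"
    unfolding B_def
  proof (rule prod.reindex_cong[OF _ refl refl])
    show "inj_on c {i \<in> {1..<m}. a (Suc i) < c i}"
    proof (rule linorder_inj_onI')
      fix i i' assume "i \<in> {i \<in> {1..<m}. a (Suc i) < c i}" "i' \<in> {i \<in> {1..<m}. a (Suc i) < c i}" "i < i'"
      then show "c i \<noteq> c i'" using separated[of i i'] less[of i'] by auto
    qed
  qed
  finally show ?thesis unfolding u_def .
qed

end

section \<open>Tableau sums as partition functions\<close>

text \<open>Conservation of paths over the first q columns: a nonzero weight excludes every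
  violating vertex, and the summand 1 is the path that enters from the left.\<close>

lemma edge_count:
  assumes "row_weight b x J I s P \<noteq> 0" "q \<le> P"
  shows "card (J \<inter> {1..q}) + 1 = card (I \<inter> {1..q}) + of_bool (edge J I q)"
  using assms(2)
proof (induction q)
  case (Suc q)
  have v: "vertex b (oplusB b x (s (Suc q))) (edge J I q) (Suc q \<in> J) (Suc q \<in> I) \<noteq> 0"
  proof
    assume "vertex b (oplusB b x (s (Suc q))) (edge J I q) (Suc q \<in> J) (Suc q \<in> I) = 0"
    then have "row_weight b x J I s P = 0"
      unfolding row_weight_def using Suc.prems by (intro prod_zero) (auto intro!: bexI[of _ "Suc q"])
    then show False using assms(1) by simp
  qed
  have card: "card (K \<inter> {1..Suc q}) = card (K \<inter> {1..q}) + of_bool (Suc q \<in> K)" for K :: "nat set"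
  proof -
    have "K \<inter> {1..Suc q} = (if Suc q \<in> K then insert (Suc q) (K \<inter> {1..q}) else K \<inter> {1..q})"
      by (auto simp: le_Suc_eq)
    then show ?thesis by simp
  qed
  show ?case
    using Suc v unfolding card[of J] card[of I]
    by (cases "edge J I q"; cases "Suc q \<in> J"; cases "Suc q \<in> I") (simp_all add: vertex_def)
qed simp

text \<open>Just left of column a i the edge must be occupied, or the weight vanishes. Conservation
  up to there shows that equally many elements of J and of I lie below a i, and these counts for all
  i amount to interlacing. The bound k' is separate because J is initially known only to lie among
  the P columns.\<close>

lemma row_weight_nonzero_imp_interlacing:
  assumes lam: "part_box (Suc n) k lam" and mu: "part_box n k' mu"
    and P: "Iset (Suc n) lam \<subseteq> {1..P}"
    and rw: "row_weight b x (Iset n mu) (Iset (Suc n) lam) s P \<noteq> 0"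
  shows "mu \<in> interlacing n lam"
proof -
  define J I where "J = Iset n mu" and "I = Iset (Suc n) lam"
  define a c where "a = (\<lambda>i. lam i + (Suc n + 1 - i))" and "c = (\<lambda>i. mu i + (n + 1 - i))"
  have I: "I = a ` {1..Suc n}" and J: "J = c ` {1..n}"
    unfolding I_def J_def a_def c_def by (rule Iset_eq_image)+
  have a_mono: "a i' < a i" if "1 \<le> i" "i < i'" "i' \<le> Suc n" for i i'
    using Iset_elements_strict_antimono[OF lam, of i i'] that by (simp add: a_def)
  have c_mono: "c i' < c i" if "1 \<le> i" "i < i'" "i' \<le> n" for i i'
    using Iset_elements_strict_antimono[OF mu, of i i'] that by (simp add: c_def)
  have inj_a: "inj_on a {1..Suc n}" and inj_c: "inj_on c {1..n}"
    unfolding a_def c_def by (rule inj_on_Iset_elements[OF lam] inj_on_Iset_elements[OF mu])+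
  have count: "card {i' \<in> {1..n}. c i' < a i} = Suc n - i" if i: "i \<in> {1..Suc n}" for i
  proof -
    have "a i \<in> I" using i unfolding I by (rule imageI)
    moreover from this have "a i \<in> {1..P}" using P unfolding I_def by blast
    ultimately have ai: "a i \<in> I" "1 \<le> a i" "a i \<le> P" by auto
    then obtain q where q: "a i = Suc q" by (cases "a i") auto
    have "edge J I q"
    proof (rule ccontr)
      assume "\<not> edge J I q"
      then have "vertex b (oplusB b x (s (Suc q))) (edge J I (Suc q - 1)) (Suc q \<in> J) (Suc q \<in> I) = 0"
        using ai q by (simp add: vertex_def)
      then have "row_weight b x J I s P = 0"
        unfolding row_weight_def using ai q by (intro prod_zero) (auto intro!: bexI[of _ "Suc q"])
      then show False using rw by (simp add: J_def I_def)
    qed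
    then have "card (J \<inter> {1..q}) = card (I \<inter> {1..q})"
      using edge_count[OF rw, of q] ai q by (simp add: I_def J_def)
    also have "I \<inter> {1..q} = a ` {i<..Suc n}"
    proof -
      have "a i' \<le> q \<longleftrightarrow> i < i'" if "i' \<in> {1..Suc n}" for i'
        using a_mono[of i i'] a_mono[of i' i] that i q by (cases i i' rule: linorder_cases) auto
      moreover have "1 \<le> a i'" if "i' \<in> {1..Suc n}" for i' using that by (auto simp: a_def)
      ultimately show ?thesis unfolding I using i by auto
    qed
    also have "card (a ` {i<..Suc n}) = Suc n - i"
      by (subst card_image) (use i in \<open>auto intro: inj_on_subset[OF inj_a]\<close>)
    also have "J \<inter> {1..q} = c ` {i' \<in> {1..n}. c i' < a i}"
      unfolding J using q by (auto simp: c_def)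
    also have "card (c ` {i' \<in> {1..n}. c i' < a i}) = card {i' \<in> {1..n}. c i' < a i}"
      by (rule card_image, rule inj_on_subset[OF inj_c]) auto
    finally show ?thesis .
  qed
  have less: "c i < a i" if i: "i \<in> {1..n}" for i
  proof (rule ccontr)
    assume "\<not> c i < a i"
    have "i < i'" if "i' \<in> {1..n}" "c i' < a i" for i'
      using c_mono[of i' i] i that \<open>\<not> c i < a i\<close> by (cases i i' rule: linorder_cases) auto
    then have "{i' \<in> {1..n}. c i' < a i} \<subseteq> {i<..n}" by auto
    then have "card {i' \<in> {1..n}. c i' < a i} \<le> card {i<..n}" by (intro card_mono) auto
    then show False using count[of i] i by auto
  qed
  have le: "a (Suc i) \<le> c i" if i: "i \<in> {1..n}" for i
  proof (rule ccontr)
    assume not: "\<not> a (Suc i) \<le> c i"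
    have "c i' < a (Suc i)" if "i' \<in> {i..n}" for i'
      using c_mono[of i i'] that i not by (cases "i = i'") auto
    then have "{i..n} \<subseteq> {i' \<in> {1..n}. c i' < a (Suc i)}" using i by auto
    then have "card {i..n} \<le> card {i' \<in> {1..n}. c i' < a (Suc i)}" by (intro card_mono) auto
    then show False using count[of "Suc i"] i by auto
  qed
  have "lam (Suc i) \<le> mu i \<and> mu i \<le> lam i" if "1 \<le> i \<and> i \<le> n" for i
    using less[of i] le[of i] that by (auto simp: a_def c_def)
  moreover have "mu 0 = 0" "\<And>i. n < i \<Longrightarrow> mu i = 0" using mu by (simp_all add: part_box_def)
  ultimately show ?thesis unfolding interlacing_def by blast
qed

text \<open>Box (i, j) goes to column Suc n + j - i, the index of the parameter that the letter n +
  1 meets there. Row i of the strip fills the columns strictly between c i and a i, and the free end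
  (i, mu i) becomes column c i.\<close>

lemma row_weight_interlacing:
  fixes b :: "'a::comm_ring_1" and s :: "nat \<Rightarrow> 'a"
  assumes lam: "part_box (Suc n) k lam" and P: "Suc n + k \<le> P" and mu: "mu \<in> interlacing n lam"
  shows "\<not> edge (Iset n mu) (Iset (Suc n) lam) P"
    and "row_weight b x (Iset n mu) (Iset (Suc n) lam) s P =
      (\<Prod>c\<in>boxes lam - boxes mu. oplusB b x (s (Suc n + snd c - fst c))) *
      (\<Prod>c\<in>free_ends lam mu. 1 + b * oplusB b x (s (Suc n + snd c - fst c)))"
proof -
  define a c where "a = (\<lambda>i. lam i + (Suc n + 1 - i))" and "c = (\<lambda>i. mu i + (n + 1 - i))"
  have mu': "lam (Suc i) \<le> mu i" "mu i \<le> lam i" if "1 \<le> i" "i \<le> n" for i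
    using mu that by (simp_all add: interlacing_def)
  have mu0: "mu i = 0" if "n < i" for i using mu that by (simp add: interlacing_def)
  have lam0: "lam i = 0" if "Suc n < i" for i using lam that by (simp add: part_box_def)
  interpret strict_interlacing "Suc n" P a c
  proof
    show "c (Suc n) = 0" using mu0 by (simp add: c_def)
    show "c i < a i" if "1 \<le> i" "i \<le> Suc n" for i
      using that mu'(2)[of i] mu0[of i] by (cases "i \<le> n") (auto simp: a_def c_def)
    show "a (Suc i) \<le> c i" if "1 \<le> i" "i < Suc n" for i
      using that mu'(1)[of i] by (auto simp: a_def c_def)
    have "lam 1 \<le> k" using lam by (simp add: part_box_def)
    then show "a 1 \<le> P" using P by (simp add: a_def)
  qed simp
  have IJ: "I = Iset (Suc n) lam" "J = Iset n mu"
    unfolding I_def J_def Iset_eq_image atLeastLessThanSuc_atLeastAtMost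
    unfolding a_def c_def by (rule refl)+
  show "\<not> edge (Iset n mu) (Iset (Suc n) lam) P" using not_edge_last IJ by simp
  define u where "u = (\<lambda>p. oplusB b x (s p))"
  have "boxes lam - boxes mu = (SIGMA i:{1..Suc n}. {mu i<..lam i})"
  proof safe
    fix i j assume ij: "(i, j) \<in> boxes lam" "(i, j) \<notin> boxes mu"
    then have "i \<le> Suc n" using lam0[of i] by (cases "i \<le> Suc n") (auto simp: boxes_def)
    then show "i \<in> {1..Suc n}" "j \<in> {mu i<..lam i}" using ij by (auto simp: boxes_def)
  qed (auto simp: boxes_def)
  then have "(\<Prod>c\<in>boxes lam - boxes mu. u (Suc n + snd c - fst c)) =
      (\<Prod>i\<in>{1..Suc n}. \<Prod>j\<in>{mu i<..lam i}. u (Suc n + j - i))"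
    by (subst prod.Sigma, simp, simp, simp only: case_prod_unfold)
  also have "\<dots> = (\<Prod>i\<in>{1..Suc n}. \<Prod>p\<in>{c i<..<a i}. u p)"
  proof (rule prod.cong[OF refl])
    fix i assume i: "i \<in> {1..Suc n}"
    show "(\<Prod>j\<in>{mu i<..lam i}. u (Suc n + j - i)) = (\<Prod>p\<in>{c i<..<a i}. u p)"
      by (rule prod.reindex_bij_witness[of _ "\<lambda>p. p + i - Suc n" "\<lambda>j. Suc n + j - i"])
        (use i in \<open>auto simp: a_def c_def\<close>)
  qed
  finally have 1: "(\<Prod>c\<in>boxes lam - boxes mu. u (Suc n + snd c - fst c)) =
      (\<Prod>i\<in>{1..Suc n}. \<Prod>p\<in>{c i<..<a i}. u p)" .
  have "free_ends lam mu = (\<lambda>i. (i, mu i)) ` {i \<in> {1..<Suc n}. a (Suc i) < c i}"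
  proof safe
    fix i j assume ij: "(i, j) \<in> free_ends lam mu"
    then have "i \<le> n" using mu0[of i] by (cases "i \<le> n") (auto simp: free_ends_def)
    then show "(i, j) \<in> (\<lambda>i. (i, mu i)) ` {i \<in> {1..<Suc n}. a (Suc i) < c i}"
      using ij by (auto simp: free_ends_def boxes_def a_def c_def)
  qed (auto simp: free_ends_def boxes_def a_def c_def)
  moreover have "inj_on (\<lambda>i. (i, mu i)) A" for A by (auto intro: inj_onI)
  ultimately have "(\<Prod>c\<in>free_ends lam mu. 1 + b * u (Suc n + snd c - fst c)) =
      (\<Prod>i\<in>{i \<in> {1..<Suc n}. a (Suc i) < c i}. 1 + b * u (Suc n + mu i - i))"
    by (simp add: prod.reindex del: One_nat_def)
  also have "\<dots> = (\<Prod>i\<in>{i \<in> {1..<Suc n}. a (Suc i) < c i}. 1 + b * u (c i))"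
    by (rule prod.cong[OF refl]) (auto simp: c_def add.commute)
  finally show "row_weight b x (Iset n mu) (Iset (Suc n) lam) s P =
      (\<Prod>c\<in>boxes lam - boxes mu. oplusB b x (s (Suc n + snd c - fst c))) *
      (\<Prod>c\<in>free_ends lam mu. 1 + b * oplusB b x (s (Suc n + snd c - fst c)))"
    using 1 row_weight_eq[of b x s] unfolding IJ u_def by simp
qed

text \<open>The largest letter is removed first, so its variable heads the list and belongs to the
  bottom row; this explains \<open>rev\<close>. The number P of columns is only bounded below
  because it stays fixed while n decreases.\<close>

theorem Groth_eq_lattice_sum:
  assumes "part_box n k lam" "n + k \<le> P"
  shows "Groth b n lam x s = lattice_sum b (map x (rev [1..<Suc n])) (Iset n lam) s P"
  using assms
proof (induction n arbitrary: lam)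
  case 0
  then have "lam = (\<lambda>i. 0)" by (auto simp: part_box_def fun_eq_iff) (metis gr0I)
  then have boxes: "boxes lam = {}" by (auto simp: boxes_def)
  then have "svt 0 lam = {\<lambda>c. {}}" by (auto simp: svt_iff fun_eq_iff)
  then show ?case by (simp add: Groth_def boxes tsize_def lattice_sum_Nil Iset_eq_image)
next
  case (Suc n)
  define xs where "xs = map x (rev [1..<Suc n])"
  define g where "g = (\<lambda>J. if edge J (Iset (Suc n) lam) P then 0
      else row_weight b (x (Suc n)) J (Iset (Suc n) lam) s P * lattice_sum b xs J s P)"
  have I: "Iset (Suc n) lam \<subseteq> {1..P}" using Iset_subset[OF Suc.prems(1)] Suc.prems(2) by auto
  have pb: "part_box n k mu" if "mu \<in> interlacing n lam" for mu
    by (rule interlacing_part_box[OF Suc.prems(1) that])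
  have "Groth b (Suc n) lam x s = (\<Sum>mu\<in>interlacing n lam. g (Iset n mu))"
    unfolding Groth_branching[OF Suc.prems(1)]
  proof (rule sum.cong[OF refl])
    fix mu assume mu: "mu \<in> interlacing n lam"
    show "(\<Prod>c\<in>boxes lam - boxes mu. oplusB b (x (Suc n)) (s (Suc n + snd c - fst c))) *
        (\<Prod>c\<in>free_ends lam mu. 1 + b * oplusB b (x (Suc n)) (s (Suc n + snd c - fst c))) *
        Groth b n mu x s = g (Iset n mu)"
      using row_weight_interlacing(1)[OF Suc.prems mu] Suc.IH[OF pb[OF mu]] Suc.prems(2)
        row_weight_interlacing(2)[OF Suc.prems mu, where b = b and x = "x (Suc n)" and s = s]
      by (simp add: g_def xs_def del: upt_Suc)
  qed
  also have "\<dots> = (\<Sum>J\<in>Iset n ` interlacing n lam. g J)"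
  proof (rule sum.reindex[symmetric, unfolded o_def])
    show "inj_on (Iset n) (interlacing n lam)"
      by (rule inj_onI) (rule Iset_inject[OF pb pb])
  qed
  also have "\<dots> = (\<Sum>J\<in>Pow {1..P}. g J)"
  proof (rule sum.mono_neutral_left)
    show "Iset n ` interlacing n lam \<subseteq> Pow {1..P}"
      using Iset_subset[OF pb] Suc.prems(2) by fastforce
    show "\<forall>J\<in>Pow {1..P} - Iset n ` interlacing n lam. g J = 0"
    proof (rule ballI, rule ccontr)
      fix J assume J: "J \<in> Pow {1..P} - Iset n ` interlacing n lam" and "g J \<noteq> 0"
      then have rw: "row_weight b (x (Suc n)) J (Iset (Suc n) lam) s P \<noteq> 0"
        and e: "\<not> edge J (Iset (Suc n) lam) P" by (auto simp: g_def split: if_splits)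
      \<comment> \<open>No edge is left on the right, so conservation over all columns fixes the
        size of J. Thus J is the index set of a partition, possibly in a box wider than k.\<close>
      have "card J + 1 = card (Iset (Suc n) lam)"
        using edge_count[OF rw, of P] e J I by (simp add: Int_absorb2)
      then have "card J = n" using card_Iset[OF Suc.prems(1)] by simp
      then have J': "part_box n (P - n) (part_of_set n J)" "Iset n (part_of_set n J) = J"
        using part_of_set[of J n "P - n"] J Suc.prems(2) by auto
      have "part_of_set n J \<in> interlacing n lam"
        by (rule row_weight_nonzero_imp_interlacing[OF Suc.prems(1) J'(1) I]) (use rw J'(2) in simp)
      then show False using J J'(2) by (metis DiffD2 imageI)
    qed
  qed auto
  also have "\<dots> = lattice_sum b (x (Suc n) # xs) (Iset (Suc n) lam) s P"
    unfolding lattice_sum_Cons g_def ..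
  also have "x (Suc n) # xs = map x (rev [1..<Suc (Suc n)])" by (simp add: xs_def)
  finally show ?case .
qed

section \<open>The action of the transposition on scalars\<close>

lemma swapj_swapj [simp]: "swapj j (swapj j i) = i"
  by (simp add: swapj_def)

lemma bij_swapj: "bij (swapj j)"
  by (rule involuntory_imp_bij) simp

lemma lookup_sigma_mon [simp]: "Poly_Mapping.lookup (sigma_mon j m) v = Poly_Mapping.lookup m (swapj j v)"
proof -
  have "finite {v. Poly_Mapping.lookup m (swapj j v) \<noteq> 0}"
    using finite_vimageI[OF finite_lookup[of m], of "swapj j"] bij_swapj[of j]
    by (simp add: bij_def vimage_def)
  then show ?thesis by (simp add: sigma_mon_def)
qed

lemma sigma_mon_involution [simp]: "sigma_mon j (sigma_mon j m) = m"
  by (rule poly_mapping_eqI) simp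

lemma sigma_mon_plus: "sigma_mon j (m + m') = sigma_mon j m + sigma_mon j m'"
  by (rule poly_mapping_eqI) (simp add: lookup_add)

lemma sigma_mon_single: "sigma_mon j (Poly_Mapping.single v c) = Poly_Mapping.single (swapj j v) c"
  by (rule poly_mapping_eqI) (auto simp: lookup_single when_def)

lemma lookup_sigma_poly [simp]: "Poly_Mapping.lookup (sigma_poly j p) m = Poly_Mapping.lookup p (sigma_mon j m)"
proof -
  have "inj (sigma_mon j)" by (rule inj_on_inverseI[of _ "sigma_mon j"]) simp
  then have "finite {m. Poly_Mapping.lookup p (sigma_mon j m) \<noteq> 0}"
    using finite_vimageI[OF finite_lookup[of p], of "sigma_mon j"] by (simp add: vimage_def)
  then show ?thesis by (simp add: sigma_poly_def)
qed

lemma sigma_poly_plus: "sigma_poly j (p + q) = sigma_poly j p + sigma_poly j q"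
  by (rule poly_mapping_eqI) (simp add: lookup_add)

lemma sigma_poly_uminus: "sigma_poly j (- p) = - sigma_poly j p"
  by (rule poly_mapping_eqI) simp

lemma sigma_poly_zero [simp]: "sigma_poly j 0 = 0"
  by (rule poly_mapping_eqI) simp

lemma sigma_poly_single:
  "sigma_poly j (Poly_Mapping.single m c) = Poly_Mapping.single (sigma_mon j m) c"
  by (rule poly_mapping_eqI) (auto simp: lookup_single when_def)

lemma sigma_poly_sum: "sigma_poly j (sum f A) = (\<Sum>a\<in>A. sigma_poly j (f a))"
  by (induction A rule: infinite_finite_induct) (simp_all add: sigma_poly_plus)

lemma sum_single_lookup: "p = (\<Sum>m\<in>Poly_Mapping.keys p. Poly_Mapping.single m (Poly_Mapping.lookup p m))"
proof (rule poly_mapping_eqI)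
  fix k
  have "(\<Sum>m\<in>Poly_Mapping.keys p. if m = k then Poly_Mapping.lookup p m else 0) = Poly_Mapping.lookup p k"
    by (subst sum.delta) (auto simp: in_keys_iff)
  then show "Poly_Mapping.lookup p k =
      Poly_Mapping.lookup (\<Sum>m\<in>Poly_Mapping.keys p. Poly_Mapping.single m (Poly_Mapping.lookup p m)) k"
    by (simp add: lookup_sum lookup_single when_def)
qed

text \<open>Both sides are biadditive, so monomials suffice, and there the permutation of exponents
  is additive.\<close>

lemma sigma_poly_times: "sigma_poly j (p * q) = sigma_poly j p * sigma_poly j q"
proof -
  define e where "e = (\<lambda>p m. Poly_Mapping.single m (Poly_Mapping.lookup p m) :: rpoly)"
  have sums: "p = sum (e p) (Poly_Mapping.keys p)" for p :: rpoly unfolding e_def by (rule sum_single_lookup)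
  have single: "sigma_poly j (e p m * e q m') = sigma_poly j (e p m) * sigma_poly j (e q m')" for p q m m'
    by (simp add: e_def mult_single sigma_poly_single sigma_mon_plus)
  have "sigma_poly j (sum (e p) A * sum (e q) B) = sigma_poly j (sum (e p) A) * sigma_poly j (sum (e q) B)" for A B
    by (simp add: sum_product sigma_poly_sum single)
  from this[of "Poly_Mapping.keys p" "Poly_Mapping.keys q"] show ?thesis by (simp flip: sums)
qed

lemma sigma_poly_one [simp]: "sigma_poly j 1 = 1"
proof -
  have "sigma_mon j 0 = 0" by (rule poly_mapping_eqI) simp
  then show ?thesis unfolding single_one[symmetric] sigma_poly_single by simp
qed

lemma sigma_poly_eq_0_iff [simp]: "sigma_poly j p = 0 \<longleftrightarrow> p = 0"
proof
  assume "sigma_poly j p = 0"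
  then have "Poly_Mapping.lookup (sigma_poly j p) (sigma_mon j m) = 0" for m by simp
  then show "p = 0" unfolding lookup_sigma_poly sigma_mon_involution by (intro poly_mapping_eqI) simp
qed simp

text \<open>Independence of the chosen representative: cross-multiplication is preserved because
  \<open>sigma_poly\<close> is multiplicative, and denominators stay nonzero because it is
  injective.\<close>

lemma sigmaK_Fract:
  assumes "b \<noteq> 0"
  shows "sigmaK j (Fraction_Field.Fract a b) = Fraction_Field.Fract (sigma_poly j a) (sigma_poly j b)"
proof -
  define c where "c = (SOME (a', b'). b' \<noteq> 0 \<and> Fraction_Field.Fract a b = Fraction_Field.Fract a' b')"
  have "case c of (a', b') \<Rightarrow> b' \<noteq> 0 \<and> Fraction_Field.Fract a b = Fraction_Field.Fract a' b'"
    unfolding c_def by (rule someI[of _ "(a, b)"]) (use assms in simp)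
  then obtain a' b' where c: "c = (a', b')" "b' \<noteq> 0" "Fraction_Field.Fract a b = Fraction_Field.Fract a' b'"
    by (cases c) auto
  then have "a * b' = a' * b" using assms by (simp add: eq_fract)
  then have "sigma_poly j a * sigma_poly j b' = sigma_poly j a' * sigma_poly j b"
    by (simp flip: sigma_poly_times)
  then show ?thesis
    unfolding sigmaK_def c_def[symmetric] using c assms by (simp add: eq_fract)
qed

lemma sigmaK_plus: "sigmaK j (x + y) = sigmaK j x + sigmaK j y"
  by (cases x, cases y) (simp add: sigmaK_Fract sigma_poly_plus sigma_poly_times)

lemma sigmaK_times: "sigmaK j (x * y) = sigmaK j x * sigmaK j y"
  by (cases x, cases y) (simp add: sigmaK_Fract sigma_poly_times)

lemma sigmaK_uminus: "sigmaK j (- x) = - sigmaK j x"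
  by (cases x) (simp add: sigmaK_Fract sigma_poly_uminus)

lemma sigmaK_zero [simp]: "sigmaK j 0 = 0"
  by (simp add: Zero_fract_def sigmaK_Fract)

lemma sigmaK_one [simp]: "sigmaK j 1 = 1"
  by (simp add: One_fract_def sigmaK_Fract)

lemma sigmaK_eq_0_iff [simp]: "sigmaK j x = 0 \<longleftrightarrow> x = 0"
  by (cases x) (simp add: sigmaK_Fract Zero_fract_def eq_fract)

lemma sigmaK_inverse: "sigmaK j (inverse x) = inverse (sigmaK j x)"
proof (cases "x = 0")
  case False
  then have "sigmaK j x * sigmaK j (inverse x) = 1"
    by (simp flip: sigmaK_times)
  then show ?thesis by (simp add: inverse_unique)
qed simp

lemma sigmaK_divide: "sigmaK j (x / y) = sigmaK j x / sigmaK j y"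
  by (simp add: divide_inverse sigmaK_times sigmaK_inverse)

lemma sigmaK_minus: "sigmaK j (x - y) = sigmaK j x - sigmaK j y"
  using sigmaK_plus[of j x "- y"] by (simp add: sigmaK_uminus)

lemma sigmaK_Xv: "sigmaK j (Fraction_Field.Fract (Xv v) 1) = Fraction_Field.Fract (Xv (swapj j v)) 1"
  by (simp add: sigmaK_Fract Xv_def sigma_poly_single sigma_mon_single)

lemma sigmaK_betaK: "1 \<le> j \<Longrightarrow> sigmaK j betaK = betaK"
  by (simp add: betaK_def sigmaK_Xv swapj_def)

lemma sigmaK_tK:
  assumes "1 \<le> j" "Suc j \<le> N"
  shows "sigmaK j (tK N m) = tK N (swapj j m)"
proof -
  have "1 \<le> swapj j m \<and> swapj j m \<le> N \<longleftrightarrow> 1 \<le> m \<and> m \<le> N"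
    using assms by (auto simp: swapj_def)
  then show ?thesis by (simp add: tK_def sigmaK_Xv)
qed

section \<open>The transposition on power series in q\<close>

lemma fps_nth_sigmaF [simp]: "fps_nth (sigmaF j f) d = sigmaK j (fps_nth f d)"
  by (simp add: sigmaF_def)

lemma sigmaF_plus: "sigmaF j (f + g) = sigmaF j f + sigmaF j g"
  by (rule fps_ext) (simp add: sigmaK_plus)

lemma sigmaF_minus: "sigmaF j (f - g) = sigmaF j f - sigmaF j g"
  by (rule fps_ext) (simp add: sigmaK_minus)

lemma sigmaF_uminus: "sigmaF j (- f) = - sigmaF j f"
  by (rule fps_ext) (simp add: sigmaK_uminus)

lemma sigmaK_sum: "sigmaK j (sum f A) = (\<Sum>a\<in>A. sigmaK j (f a))"
  by (induction A rule: infinite_finite_induct) (simp_all add: sigmaK_plus)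

lemma sigmaF_times: "sigmaF j (f * g) = sigmaF j f * sigmaF j g"
  by (rule fps_ext) (simp add: fps_mult_nth sigmaK_sum sigmaK_times)

lemma sigmaF_const: "sigmaF j (fps_const c) = fps_const (sigmaK j c)"
  by (rule fps_ext) simp

lemma sigmaF_zero [simp]: "sigmaF j 0 = 0"
  by (rule fps_ext) simp

lemma sigmaF_one [simp]: "sigmaF j 1 = 1"
  by (rule fps_ext) simp

lemma sigmaF_X: "sigmaF j fps_X = fps_X"
  by (rule fps_ext) (simp add: fps_X_def)

lemma sigmaF_sum: "sigmaF j (sum f A) = (\<Sum>a\<in>A. sigmaF j (f a))"
  by (induction A rule: infinite_finite_induct) (simp_all add: sigmaF_plus)

lemma sigmaF_prod: "sigmaF j (prod f A) = (\<Prod>a\<in>A. sigmaF j (f a))"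
  by (induction A rule: infinite_finite_induct) (simp_all add: sigmaF_times)

lemma sigmaF_power: "sigmaF j (f ^ m) = sigmaF j f ^ m"
  by (induction m) (simp_all add: sigmaF_times)

lemma sigmaF_divide:
  assumes "fps_nth g 0 \<noteq> 0"
  shows "sigmaF j (f / g) = sigmaF j f / sigmaF j g"
proof -
  have "sigmaF j g * sigmaF j (inverse g) = 1"
    using assms by (simp add: inverse_mult_eq_1' flip: sigmaF_times)
  then have "sigmaF j (inverse g) = inverse (sigmaF j g)"
    by (metis fps_inverse_unique)
  then show ?thesis using assms by (simp add: fps_divide_unit sigmaF_times)
qed

lemma sigmaF_Groth:
  "sigmaF j (Groth b n lam x s) = Groth (sigmaF j b) n lam (\<lambda>r. sigmaF j (x r)) (\<lambda>m. sigmaF j (s m))"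
  unfolding Groth_def oplusB_def
  by (simp add: sigmaF_sum sigmaF_times sigmaF_prod sigmaF_power sigmaF_plus case_prod_beta)

section \<open>Nonvanishing of the scalars that occur in denominators\<close>

lemma tK_inject:
  assumes "1 \<le> i" "i \<le> N" "1 \<le> i'" "i' \<le> N"
  shows "tK N i = tK N i' \<longleftrightarrow> i = i'"
proof -
  have "i = i'" if "Xv i = Xv i'"
  proof -
    have "Poly_Mapping.lookup (Xv i') (Poly_Mapping.single i 1) \<noteq> 0"
      unfolding that[symmetric] by (simp add: Xv_def)
    then have "Poly_Mapping.single i' 1 = (Poly_Mapping.single i 1 :: nat \<Rightarrow>\<^sub>0 nat)"
      by (simp add: Xv_def lookup_single when_def split: if_splits)
    then have "Poly_Mapping.lookup (Poly_Mapping.single i' (1::nat)) i = 1" by simp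
    then show ?thesis by (simp add: lookup_single when_def split: if_splits)
  qed
  then have "Xv i = Xv i' \<longleftrightarrow> i = i'" by blast
  then show ?thesis using assms by (simp add: tK_def eq_fract)
qed

text \<open>The polynomial 1 + X_0 X_i has constant coefficient 1; for an index out of range t_i is
  0.\<close>

lemma one_plus_betaK_tK: "1 + betaK * tK N i \<noteq> 0"
proof (cases "1 \<le> i \<and> i \<le> N")
  case True
  define e :: "nat \<Rightarrow>\<^sub>0 nat" where "e = Poly_Mapping.single 0 1 + Poly_Mapping.single i 1"
  have "Poly_Mapping.lookup e 0 \<noteq> 0" by (simp add: e_def lookup_add)
  then have "e \<noteq> 0" by auto
  have prod: "Xv 0 * Xv i = Poly_Mapping.single e 1" by (simp add: Xv_def e_def mult_single)
  have "Poly_Mapping.lookup (1 + Xv 0 * Xv i) 0 = 1"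
    using \<open>e \<noteq> 0\<close> by (simp add: prod lookup_add lookup_single lookup_one)
  then have "1 + Xv 0 * Xv i \<noteq> 0" by (metis lookup_zero zero_neq_one)
  then show ?thesis using True by (simp add: tK_def betaK_def One_fract_def Zero_fract_def eq_fract)
next
  case False
  then have "tK N i = 0" by (auto simp: tK_def)
  then show ?thesis by simp
qed

section \<open>Bethe roots\<close>

text \<open>Congruence modulo q^d, the q-adic distance for the fixed-point argument.\<close>

definition agree :: "nat \<Rightarrow> 'a::zero fps \<Rightarrow> 'a fps \<Rightarrow> bool" where
  "agree d f g \<longleftrightarrow> (\<forall>e<d. fps_nth f e = fps_nth g e)"

lemma agree_refl: "agree d f f"
  by (simp add: agree_def)

lemma agree_plus: "agree d f f' \<Longrightarrow> agree d g g' \<Longrightarrow> agree d (f + g) (f' + g')"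
  for f f' :: "'a::comm_ring_1 fps"
  by (simp add: agree_def)

lemma agree_minus: "agree d f f' \<Longrightarrow> agree d g g' \<Longrightarrow> agree d (f - g) (f' - g')"
  for f f' :: "'a::comm_ring_1 fps"
  by (simp add: agree_def)

lemma agree_times: "agree d f f' \<Longrightarrow> agree d g g' \<Longrightarrow> agree d (f * g) (f' * g')"
  for f f' :: "'a::comm_ring_1 fps"
  by (auto simp: agree_def fps_mult_nth intro!: sum.cong)

lemma agree_prod: "(\<And>a. a \<in> A \<Longrightarrow> agree d (f a) (g a)) \<Longrightarrow> agree d (prod f A) (prod g A)"
  for f g :: "'b \<Rightarrow> 'a::comm_ring_1 fps"
  by (induction A rule: infinite_finite_induct) (simp_all add: agree_refl agree_times)

lemma agree_power: "agree d f g \<Longrightarrow> agree d (f ^ m) (g ^ m)"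
  for f g :: "'a::comm_ring_1 fps"
  by (induction m) (simp_all add: agree_refl agree_times)

lemma agree_inverse:
  fixes f g :: "'a::field fps"
  assumes "agree d f g" "fps_nth f 0 \<noteq> 0" "fps_nth g 0 \<noteq> 0"
  shows "agree d (inverse f) (inverse g)"
proof -
  have "inverse f - inverse g = (inverse f * inverse g) * (g - f)"
    using inverse_mult_eq_1[OF assms(2)] inverse_mult_eq_1[OF assms(3)] by algebra
  moreover have "agree d ((inverse f * inverse g) * (g - f)) ((inverse f * inverse g) * (g - g))"
    using assms(1) by (intro agree_times agree_refl) (simp add: agree_def)
  ultimately have "agree d (inverse f - inverse g) 0" by (simp add: agree_def)
  then show ?thesis by (simp add: agree_def)
qed

lemma agree_X_times: "agree d f g \<Longrightarrow> agree (Suc d) (fps_X * f) (fps_X * g)"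
  for f g :: "'a::comm_ring_1 fps"
  by (auto simp: agree_def)

text \<open>The contraction principle in the q-adic metric: each application fixes one more
  coefficient, so the diagonal of the iterates is the limit. Contraction is demanded only between
  families with constant terms c, because the Bethe map inverts a series that is known to be a unit
  only there.\<close>

lemma contraction_unique_fixpoint:
  fixes \<Phi> :: "(nat \<Rightarrow> 'a::comm_ring_1 fps) \<Rightarrow> nat \<Rightarrow> 'a fps"
  assumes const: "\<And>y i. fps_nth (\<Phi> y i) 0 = c i"
    and contr: "\<And>d y z i. (\<And>i. fps_nth (y i) 0 = c i) \<Longrightarrow> (\<And>i. fps_nth (z i) 0 = c i) \<Longrightarrow>
      (\<And>i. agree d (y i) (z i)) \<Longrightarrow> agree (Suc d) (\<Phi> y i) (\<Phi> z i)"
  shows "\<exists>!y. (\<forall>i. fps_nth (y i) 0 = c i) \<and> \<Phi> y = y"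
proof (rule ex_ex1I)
  define Y where "Y = (\<lambda>d. (\<Phi> ^^ d) (\<lambda>i. fps_const (c i)))"
  have Y_Suc: "Y (Suc d) = \<Phi> (Y d)" for d by (simp add: Y_def)
  have Y0: "fps_nth (Y d i) 0 = c i" for d i by (cases d) (simp_all add: Y_def const)
  have step: "agree (Suc d) (Y (Suc d) i) (Y d i)" for d i
  proof (induction d arbitrary: i)
    case 0 then show ?case by (simp add: agree_def Y0)
  next
    case (Suc d)
    show ?case unfolding Y_Suc[of "Suc d"] by (subst Y_Suc[of d]) (rule contr[OF Y0 Y0 Suc])
  qed
  define y where "y = (\<lambda>i. Abs_fps (\<lambda>d. fps_nth (Y d i) d))"
  have limit: "fps_nth (Y d i) e = fps_nth (y i) e" if "e \<le> d" for d e i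
    using that
  proof (induction rule: dec_induct)
    case base show ?case by (simp add: y_def)
  next
    case (step m) then show ?case using \<open>\<And>i d. agree (Suc d) (Y (Suc d) i) (Y d i)\<close>[of m i] by (simp add: agree_def)
  qed
  have y0: "fps_nth (y i) 0 = c i" for i by (simp add: y_def Y0)
  have "\<Phi> y = y"
  proof (intro ext fps_ext)
    fix i e
    have "agree (Suc e) (\<Phi> y i) (\<Phi> (Y e) i)"
      by (rule contr) (simp_all add: y0 Y0 agree_def limit)
    then have "fps_nth (\<Phi> y i) e = fps_nth (Y (Suc e) i) e" by (simp add: agree_def Y_Suc)
    then show "fps_nth (\<Phi> y i) e = fps_nth (y i) e" by (simp add: limit)
  qed
  then show "\<exists>y. (\<forall>i. fps_nth (y i) 0 = c i) \<and> \<Phi> y = y" using y0 by blast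
next
  fix y z
  assume y: "(\<forall>i. fps_nth (y i) 0 = c i) \<and> \<Phi> y = y" and z: "(\<forall>i. fps_nth (z i) 0 = c i) \<and> \<Phi> z = z"
  have "agree d (y i) (z i)" for d i
  proof (induction d arbitrary: i)
    case (Suc d)
    then have "agree (Suc d) (\<Phi> y i) (\<Phi> z i)" using y z by (intro contr) auto
    then show ?case using y z by simp
  qed (simp add: agree_def)
  then have "fps_nth (y i) d = fps_nth (z i) d" for i d
    unfolding agree_def by (meson lessI)
  then show "y = z" by (intro ext fps_ext)
qed

text \<open>The i-th Bethe expression without q and without the factor y_i - t_i, the only one that
  vanishes modulo q. The equation becomes y_i = t_i - q / cofactor, and the factor q makes this map
  contracting.\<close>

definition bethe_cofactor :: "nat \<Rightarrow> nat \<Rightarrow> nat set \<Rightarrow> (nat \<Rightarrow> rf fps) \<Rightarrow> nat \<Rightarrow> rf fps" where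
  "bethe_cofactor n N I y i =
     (-1) ^ n * (\<Prod>l\<in>I. 1 + fps_const betaK * y l) * inverse ((1 + fps_const betaK * y i) ^ n)
       * ((\<Prod>m\<in>{1..N} - {i}. ominusB (fps_const betaK) (y i) (fps_const (tK N m)))
       * fps_const (inverse (1 + betaK * tK N i)))"

lemma ominusB_const:
  "ominusB (fps_const betaK) f (fps_const (tK N m)) =
     (f - fps_const (tK N m)) * fps_const (inverse (1 + betaK * tK N m))"
proof -
  have "1 + fps_const betaK * fps_const (tK N m) = fps_const (1 + betaK * tK N m)"
    by (simp flip: fps_const_add)
  then show ?thesis using one_plus_betaK_tK[of N m]
    by (simp add: ominusB_def fps_divide_unit fps_const_inverse)
qed

lemma bethe_eq_iff:
  assumes "i \<in> {1..N}" "fps_nth (y i) 0 = tK N i"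
  shows "(-1) ^ n * (\<Prod>l\<in>I. 1 + fps_const betaK * y l) / (1 + fps_const betaK * y i) ^ n
       * (\<Prod>m\<in>{1..N}. ominusB (fps_const betaK) (y i) (fps_const (tK N m))) =
     bethe_cofactor n N I y i * (y i - fps_const (tK N i))"
proof -
  have nz: "fps_nth ((1 + fps_const betaK * y i) ^ n) 0 \<noteq> 0"
    using assms(2) one_plus_betaK_tK[of N i] by (simp add: fps_power_zeroth)
  have "(\<Prod>m\<in>{1..N}. ominusB (fps_const betaK) (y i) (fps_const (tK N m))) =
      ominusB (fps_const betaK) (y i) (fps_const (tK N i)) *
      (\<Prod>m\<in>{1..N} - {i}. ominusB (fps_const betaK) (y i) (fps_const (tK N m)))"
    using assms(1) by (intro prod.remove) auto
  then show ?thesis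
    unfolding bethe_cofactor_def fps_divide_unit[OF nz] ominusB_const[of "y i" N i]
    by (simp only: mult_ac)
qed

lemma fps_prod_zeroth: "fps_nth (prod f A) 0 = (\<Prod>a\<in>A. fps_nth (f a) 0)"
  for f :: "'b \<Rightarrow> 'a::comm_ring_1 fps"
  by (induction A rule: infinite_finite_induct) simp_all

text \<open>Modulo q the factors are differences t_i - t_m with m different from i and factors 1 +
  beta t or their inverses, up to sign; all are nonzero.\<close>

lemma bethe_cofactor_unit:
  assumes I: "I \<subseteq> {1..N}" "i \<in> I" and y: "\<And>l. l \<in> I \<Longrightarrow> fps_nth (y l) 0 = tK N l"
  shows "fps_nth (bethe_cofactor n N I y i) 0 \<noteq> 0"
proof -
  have fin: "finite I" using I(1) by (rule finite_subset) simp
  have i: "i \<in> {1..N}" using I by blast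
  have "fps_nth (1 + fps_const betaK * y l) 0 \<noteq> 0" if "l \<in> I" for l
    using that y one_plus_betaK_tK by simp
  then have 1: "fps_nth (\<Prod>l\<in>I. 1 + fps_const betaK * y l) 0 \<noteq> 0"
    using fin unfolding fps_prod_zeroth by (simp add: prod_zero_iff)
  have 2: "fps_nth (inverse ((1 + fps_const betaK * y i) ^ n)) 0 \<noteq> 0"
    using I(2) y one_plus_betaK_tK by (simp add: fps_power_zeroth)
  have "fps_nth (ominusB (fps_const betaK) (y i) (fps_const (tK N m))) 0 \<noteq> 0" if "m \<in> {1..N} - {i}" for m
    using that i y[OF I(2)] one_plus_betaK_tK[of N m] tK_inject[of i N m] by (simp add: ominusB_const)
  then have 3: "fps_nth (\<Prod>m\<in>{1..N} - {i}. ominusB (fps_const betaK) (y i) (fps_const (tK N m))) 0 \<noteq> 0"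
    unfolding fps_prod_zeroth by (simp add: prod_zero_iff)
  show ?thesis
    using 1 2 3 one_plus_betaK_tK[of N i] by (simp add: bethe_cofactor_def fps_power_zeroth)
qed

lemma agree_bethe_cofactor:
  assumes I: "I \<subseteq> {1..N}" "i \<in> I" and y: "\<And>l. l \<in> I \<Longrightarrow> fps_nth (y l) 0 = tK N l"
    and z: "\<And>l. l \<in> I \<Longrightarrow> fps_nth (z l) 0 = tK N l" and yz: "\<And>l. agree d (y l) (z l)"
  shows "agree d (bethe_cofactor n N I y i) (bethe_cofactor n N I z i)"
  unfolding bethe_cofactor_def ominusB_const
  by (intro agree_times agree_prod agree_inverse agree_power agree_plus agree_minus agree_refl yz)
    (use y[OF I(2)] z[OF I(2)] one_plus_betaK_tK in \<open>simp_all add: fps_power_zeroth\<close>)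

definition is_bethe_root :: "nat \<Rightarrow> nat \<Rightarrow> nat set \<Rightarrow> (nat \<Rightarrow> rf fps) \<Rightarrow> bool" where
  "is_bethe_root n N I y \<longleftrightarrow> (\<forall>i\<in>I. fps_nth (y i) 0 = tK N i) \<and> (\<forall>i. i \<notin> I \<longrightarrow> y i = 0) \<and> bethe_eqs n N I y"

text \<open>Setting the map to 0 outside I makes both the normalisation of the root and the Bethe
  equations part of one fixed-point equation on families indexed by all natural numbers.\<close>

lemma ex1_bethe_root:
  assumes I: "I \<subseteq> {1..N}"
  shows "\<exists>!y. is_bethe_root n N I y"
proof -
  define c where "c = (\<lambda>i. if i \<in> I then tK N i else 0)"
  define \<Phi> where "\<Phi> = (\<lambda>y i. if i \<in> I then fps_const (tK N i) - fps_X * inverse (bethe_cofactor n N I y i) else 0)"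
  have "\<exists>!y. (\<forall>i. fps_nth (y i) 0 = c i) \<and> \<Phi> y = y"
  proof (rule contraction_unique_fixpoint)
    show "fps_nth (\<Phi> y i) 0 = c i" for y i by (simp add: \<Phi>_def c_def)
    fix d y z i
    assume y: "\<And>i. fps_nth (y i) 0 = c i" and z: "\<And>i. fps_nth (z i) 0 = c i" and yz: "\<And>i. agree d (y i) (z i)"
    have y': "fps_nth (y l) 0 = tK N l" and z': "fps_nth (z l) 0 = tK N l" if "l \<in> I" for l
      using y z that by (simp_all add: c_def)
    show "agree (Suc d) (\<Phi> y i) (\<Phi> z i)"
    proof (cases "i \<in> I")
      case True
      have "agree d (inverse (bethe_cofactor n N I y i)) (inverse (bethe_cofactor n N I z i))"
        using I True y' z' yz by (intro agree_inverse agree_bethe_cofactor bethe_cofactor_unit)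
      then show ?thesis unfolding \<Phi>_def using True by (auto intro!: agree_minus agree_X_times agree_refl)
    qed (simp add: \<Phi>_def agree_refl)
  qed
  moreover have "is_bethe_root n N I y \<longleftrightarrow> (\<forall>i. fps_nth (y i) 0 = c i) \<and> \<Phi> y = y" for y
  proof (cases "(\<forall>i\<in>I. fps_nth (y i) 0 = tK N i) \<and> (\<forall>i. i \<notin> I \<longrightarrow> y i = 0)")
    case True
    then have y: "fps_nth (y l) 0 = tK N l" if "l \<in> I" for l using that by blast
    have eq: "bethe_cofactor n N I y i * (y i - fps_const (tK N i)) + fps_X = 0 \<longleftrightarrow> \<Phi> y i = y i" if i: "i \<in> I" for i
    proof -
      have inv: "inverse (bethe_cofactor n N I y i) * bethe_cofactor n N I y i = 1"
        by (rule inverse_mult_eq_1) (rule bethe_cofactor_unit[OF I i y])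
      have "bethe_cofactor n N I y i * (y i - fps_const (tK N i)) + fps_X = 0 \<longleftrightarrow>
          fps_const (tK N i) - fps_X * inverse (bethe_cofactor n N I y i) = y i"
        using inv by algebra
      then show ?thesis using i by (simp add: \<Phi>_def)
    qed
    have "bethe_eqs n N I y \<longleftrightarrow> (\<forall>i\<in>I. bethe_cofactor n N I y i * (y i - fps_const (tK N i)) + fps_X = 0)"
      unfolding bethe_eqs_def using I y by (intro ball_cong[OF refl]) (subst bethe_eq_iff, auto)
    also have "\<dots> \<longleftrightarrow> (\<forall>i\<in>I. \<Phi> y i = y i)" using eq by blast
    also have "\<dots> \<longleftrightarrow> \<Phi> y = y" using True by (auto simp: fun_eq_iff \<Phi>_def)
    finally have "bethe_eqs n N I y \<longleftrightarrow> \<Phi> y = y" .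
    then show ?thesis using True by (auto simp: is_bethe_root_def c_def)
  next
    case False
    then have "\<not> is_bethe_root n N I y" by (auto simp: is_bethe_root_def)
    moreover have "\<not> ((\<forall>i. fps_nth (y i) 0 = c i) \<and> \<Phi> y = y)"
    proof
      assume *: "(\<forall>i. fps_nth (y i) 0 = c i) \<and> \<Phi> y = y"
      then have "\<Phi> y i = y i" for i by simp
      then have "y i = 0" if "i \<notin> I" for i using that unfolding \<Phi>_def by metis
      then show False using * False by (auto simp: c_def)
    qed
    ultimately show ?thesis by blast
  qed
  ultimately show ?thesis by simp
qed

lemma bethe_root_eq_The: "bethe_root n N nu = (THE y. is_bethe_root n N (Iset n nu) y)"
  unfolding bethe_root_def is_bethe_root_def ..

lemma is_bethe_root: "Iset n nu \<subseteq> {1..N} \<Longrightarrow> is_bethe_root n N (Iset n nu) (bethe_root n N nu)"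
  unfolding bethe_root_eq_The by (rule theI'[OF ex1_bethe_root])

lemma bethe_root_eqI:
  "Iset n nu \<subseteq> {1..N} \<Longrightarrow> is_bethe_root n N (Iset n nu) y \<Longrightarrow> bethe_root n N nu = y"
  unfolding bethe_root_eq_The by (rule the1_equality[OF ex1_bethe_root])

text \<open>\<open>sigmaF j\<close> respects the ring operations and fixes beta and q. The product
  over all t_m is only reindexed, so the equations keep their form, and relabelling the components
  by \<open>swapj j\<close> restores the constant terms. Outside the index set both sides are 0, so
  every i is allowed.\<close>

lemma bethe_root_swap:
  assumes j: "1 \<le> j" "Suc j \<le> N" and mu: "Iset n mu \<subseteq> {1..N}"
    and smu: "Iset n smu = swapj j ` Iset n mu"
  shows "sigmaF j (bethe_root n N smu i) = bethe_root n N mu (swapj j i)"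
proof -
  define y where "y = bethe_root n N smu"
  define z where "z = (\<lambda>i. sigmaF j (y (swapj j i)))"
  define I where "I = Iset n mu"
  have mem: "swapj j i \<in> swapj j ` A \<longleftrightarrow> i \<in> A" for i A
    using bij_swapj[of j] by (simp add: bij_def inj_image_mem_iff)
  have inj: "inj_on (swapj j) A" for A
    using bij_swapj[of j] by (auto simp: bij_def intro: inj_on_subset)
  have swapN: "swapj j ` {1..N} = {1..N}"
  proof -
    have "swapj j ` {1..N} \<subseteq> {1..N}" using j by (auto simp: swapj_def)
    moreover from this have "swapj j ` swapj j ` {1..N} \<subseteq> swapj j ` {1..N}" by (rule image_mono)
    ultimately show ?thesis by (simp add: image_image)
  qed
  have sI: "swapj j ` I \<subseteq> {1..N}" using mu swapN by (auto simp: I_def)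
  have y: "is_bethe_root n N (swapj j ` I) y"
    using is_bethe_root[of n smu N] sI by (simp add: y_def smu I_def)
  have y0: "fps_nth (y (swapj j i)) 0 = tK N (swapj j i)" if "i \<in> I" for i
    using y that by (auto simp: is_bethe_root_def)
  have "is_bethe_root n N I z"
    unfolding is_bethe_root_def
  proof (intro conjI ballI allI impI)
    show "fps_nth (z i) 0 = tK N i" if "i \<in> I" for i
      using that j by (simp add: z_def y0 sigmaK_tK)
    show "z i = 0" if "i \<notin> I" for i
      using that y by (simp add: z_def is_bethe_root_def mem)
    show "bethe_eqs n N I z"
      unfolding bethe_eqs_def
    proof
      fix i assume i: "i \<in> I"
      have nz: "fps_nth ((1 + fps_const betaK * y (swapj j i)) ^ n) 0 \<noteq> 0"
        using one_plus_betaK_tK by (simp add: fps_power_zeroth y0[OF i])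
      have o: "sigmaF j (ominusB (fps_const betaK) (y (swapj j i)) (fps_const (tK N m))) =
          ominusB (fps_const betaK) (z i) (fps_const (tK N (swapj j m)))" for m
        unfolding ominusB_const using j
        by (simp add: sigmaF_times sigmaF_minus sigmaF_const sigmaK_inverse sigmaK_plus sigmaK_times
            sigmaK_betaK sigmaK_tK z_def)
      have "(-1) ^ n * (\<Prod>l\<in>swapj j ` I. 1 + fps_const betaK * y l) / (1 + fps_const betaK * y (swapj j i)) ^ n
        * (\<Prod>m\<in>{1..N}. ominusB (fps_const betaK) (y (swapj j i)) (fps_const (tK N m))) + fps_X = 0"
        using y i by (auto simp: is_bethe_root_def bethe_eqs_def)
      then have "sigmaF j ((-1) ^ n * (\<Prod>l\<in>swapj j ` I. 1 + fps_const betaK * y l) / (1 + fps_const betaK * y (swapj j i)) ^ n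
        * (\<Prod>m\<in>{1..N}. ominusB (fps_const betaK) (y (swapj j i)) (fps_const (tK N m))) + fps_X) = 0"
        by simp
      moreover have "(\<Prod>m\<in>{1..N}. ominusB (fps_const betaK) (z i) (fps_const (tK N (swapj j m)))) =
          (\<Prod>m\<in>{1..N}. ominusB (fps_const betaK) (z i) (fps_const (tK N m)))"
        using prod.reindex[of "swapj j" "{1..N}" "\<lambda>m. ominusB (fps_const betaK) (z i) (fps_const (tK N m))", OF inj]
        by (simp only: swapN o_def)
      ultimately show "(-1) ^ n * (\<Prod>l\<in>I. 1 + fps_const betaK * z l) / (1 + fps_const betaK * z i) ^ n
        * (\<Prod>m\<in>{1..N}. ominusB (fps_const betaK) (z i) (fps_const (tK N m))) + fps_X = 0"
        using j
        by (simp add: sigmaF_plus sigmaF_times sigmaF_divide[OF nz] sigmaF_power sigmaF_uminus sigmaF_prod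
            sigmaF_X sigmaF_const sigmaK_betaK o prod.reindex[OF inj] o_def z_def[THEN fun_cong, symmetric])
    qed
  qed
  then have "bethe_root n N mu = z" using bethe_root_eqI[OF mu] by (simp add: I_def)
  then show ?thesis by (simp add: z_def y_def)
qed

section \<open>The difference formula\<close>

lemma Groth_cong_vars:
  assumes "part_box n k lam" "\<And>r. 1 \<le> r \<Longrightarrow> r \<le> n \<Longrightarrow> x r = x' r"
  shows "Groth b n lam x s = Groth b n lam x' s"
proof -
  have "map x (rev [1..<Suc n]) = map x' (rev [1..<Suc n])"
    using assms(2) by (intro map_cong) auto
  then show ?thesis
    using Groth_eq_lattice_sum[OF assms(1) order_refl] by metis
qed

lemma Groth_swap_vars:
  fixes b :: "'a::idom"
  assumes lam: "part_box n k lam" and r: "1 \<le> r" "r < n" and nz: "1 + b * x r \<noteq> 0"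
  shows "Groth b n lam (\<lambda>i. x (swapj r i)) s = Groth b n lam x s"
proof -
  define us vs where "us = rev [Suc (Suc r)..<Suc n]" and "vs = rev [1..<r]"
  \<comment> \<open>The list descends, so \<open>Suc r\<close> precedes r; its two middle entries
    are the adjacent rows to be exchanged.\<close>
  have upt: "rev [1..<Suc n] = us @ Suc r # r # vs"
    unfolding upt_split_pair[OF r] us_def vs_def by simp
  have "map (\<lambda>i. x (swapj r i)) us = map x us" "map (\<lambda>i. x (swapj r i)) vs = map x vs"
    by (auto simp: us_def vs_def swapj_def)
  moreover have "swapj r r = Suc r" "swapj r (Suc r) = r" by (simp_all add: swapj_def)
  ultimately have "Groth b n lam (\<lambda>i. x (swapj r i)) s =
      lattice_sum b (map x us @ x r # x (Suc r) # map x vs) (Iset n lam) s (n + k)"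
    unfolding Groth_eq_lattice_sum[OF lam order_refl] upt by (simp only: map_append list.map)
  also have "\<dots> = lattice_sum b (map x us @ x (Suc r) # x r # map x vs) (Iset n lam) s (n + k)"
    using lattice_sum_exchange[of b "x r" "map x us" "x (Suc r)" "map x vs"] nz by simp
  also have "\<dots> = Groth b n lam x s"
    unfolding Groth_eq_lattice_sum[OF lam order_refl] upt by simp
  finally show ?thesis .
qed

lemma sj_part:
  assumes "part_box n k lam" "1 \<le> j" "j < n + k"
  shows "part_box n k (sj_part n j lam)" "Iset n (sj_part n j lam) = swapj j ` Iset n lam"
proof -
  have inj: "inj_on (swapj j) (Iset n lam)"
    using bij_swapj[of j] by (auto simp: bij_def intro: inj_on_subset)
  have "swapj j ` Iset n lam \<subseteq> {1..n + k}"
    using Iset_subset[OF assms(1)] assms(2,3) by (fastforce simp: swapj_def)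
  moreover have "card (swapj j ` Iset n lam) = n"
    using card_Iset[OF assms(1)] by (simp add: card_image[OF inj])
  ultimately show "part_box n k (sj_part n j lam)" "Iset n (sj_part n j lam) = swapj j ` Iset n lam"
    unfolding sj_part_def by (rule part_of_set)+
qed

lemma Groth_swap_params:
  assumes lam: "part_box n k lam" and j: "1 \<le> j" "j < n + k"
  shows "\<not> (j \<notin> Iset n lam \<and> Suc j \<in> Iset n lam) \<Longrightarrow>
      Groth b n lam x (\<lambda>m. s (swapj j m)) = Groth b n lam x s"
    and "j \<notin> Iset n lam \<Longrightarrow> Suc j \<in> Iset n lam \<Longrightarrow>
      (1 + b * s j) * (Groth b n lam x (\<lambda>m. s (swapj j m)) - Groth b n lam x s) =
      (s (Suc j) - s j) * (b * Groth b n lam x s + Groth b n (sj_part n j lam) x s)"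
  using lattice_sum_swap[OF j, where I = "Iset n lam" and b = b and s = s]
  unfolding Groth_eq_lattice_sum[OF lam order_refl]
    Groth_eq_lattice_sum[OF sj_part(1)[OF lam j] order_refl] sj_part(2)[OF lam j]
  by blast+

text \<open>The only pair whose order \<open>swapj j\<close> reverses is j, j + 1.\<close>

lemma sorted_list_of_set_swapj:
  assumes "finite I" "\<not> (j \<in> I \<and> Suc j \<in> I)"
  shows "sorted_list_of_set (swapj j ` I) = map (swapj j) (sorted_list_of_set I)"
proof -
  have "sorted_wrt (\<lambda>a b. swapj j a < swapj j b) (sorted_list_of_set I)"
  proof (rule sorted_wrt_mono_rel)
    show "sorted_wrt (<) (sorted_list_of_set I)" by (simp add: strict_sorted_iff)
    fix a b assume "a \<in> set (sorted_list_of_set I)" "b \<in> set (sorted_list_of_set I)" "a < b"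
    then show "swapj j a < swapj j b" using assms by (auto simp: swapj_def)
  qed
  then have "sorted_wrt (<) (map (swapj j) (sorted_list_of_set I))" by (simp add: sorted_wrt_map)
  then show ?thesis
    using assms(1) by (intro sorted_distinct_set_unique) (simp_all add: strict_sorted_iff)
qed

lemma sigmaF_G_at:
  assumes lam: "part_box n k lam" and mu: "part_box n k mu" and j: "1 \<le> j" "j < n + k"
  shows "sigmaF j (G_at n (n + k) lam (sj_part n j mu)) =
    Groth (fps_const betaK) n lam (\<lambda>r. bethe_root n (n + k) mu (sorted_list_of_set (Iset n mu) ! (r - 1)))
      (\<lambda>m. fps_const (uminusB betaK (tK (n + k) (swapj j m))))"
proof -
  define N where "N = n + k"
  define I where "I = Iset n mu"
  define L where "L = sorted_list_of_set I"
  define L' where "L' = sorted_list_of_set (swapj j ` I)"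
  define x where "x = (\<lambda>r. bethe_root n N mu (L ! (r - 1)))"
  define s where "s = (\<lambda>m. fps_const (uminusB betaK (tK N (swapj j m))))"
  have IN: "Iset n mu \<subseteq> {1..N}" using Iset_subset[OF mu] by (simp add: N_def)
  have fin: "finite I" by (simp add: I_def finite_Iset)
  have L: "length L = n" "set L = I" "distinct L" "sorted_wrt (<) L"
    using fin card_Iset[OF mu] by (simp_all add: L_def I_def strict_sorted_iff)
  have param: "sigmaF j (fps_const (uminusB betaK (tK N m))) = s m" for m
    using j by (simp add: s_def uminusB_def sigmaF_const sigmaK_divide sigmaK_uminus sigmaK_plus
        sigmaK_times sigmaK_betaK sigmaK_tK N_def)
  have "sigmaF j (G_at n N lam (sj_part n j mu)) =
      Groth (fps_const betaK) n lam (\<lambda>r. bethe_root n N mu (swapj j (L' ! (r - 1)))) s"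
    unfolding G_at_def sigmaF_Groth param
    unfolding sigmaF_const sigmaK_betaK[OF j(1)] sj_part(2)[OF mu j] I_def[symmetric] L'_def[symmetric]
    by (subst bethe_root_swap[OF j(1) _ IN sj_part(2)[OF mu j]]) (use j in \<open>simp_all add: N_def\<close>)
  also have "\<dots> = Groth (fps_const betaK) n lam x s"
  proof (cases "j \<in> I \<and> Suc j \<in> I")
    case False
    \<comment> \<open>Sorting commutes with the relabelling here, so the two relabellings cancel
      position by position.\<close>
    then have "L' = map (swapj j) L" unfolding L'_def L_def using fin by (intro sorted_list_of_set_swapj)
    then show ?thesis using L(1) by (intro Groth_cong_vars[OF lam]) (simp add: x_def)
  next
    case True
    have "swapj j ` I = I"
    proof -
      have "swapj j ` I \<subseteq> I" using True by (auto simp: swapj_def)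
      moreover from this have "swapj j ` swapj j ` I \<subseteq> swapj j ` I" by (rule image_mono)
      ultimately show ?thesis by (simp add: image_image)
    qed
    then have L': "L' = L" by (simp add: L'_def L_def)
    obtain p where p: "p < n" "L ! p = j" using True L(1,2) by (metis in_set_conv_nth)
    obtain p' where p': "p' < n" "L ! p' = Suc j" using True L(1,2) by (metis in_set_conv_nth)
    have mono: "L ! a < L ! b" if "a < b" "b < n" for a b
      using sorted_wrt_nth_less[OF L(4)] L(1) that by simp
    \<comment> \<open>No integer lies between j and j + 1, so they occupy consecutive positions of
      the sorted list.\<close>
    have "p < p'" using mono[of p' p] p p' by (cases p p' rule: linorder_cases) auto
    moreover have "\<not> Suc p < p'"
      using mono[of p "Suc p"] mono[of "Suc p" p'] p p' by auto
    ultimately have p'_eq: "p' = Suc p" by simp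
    \<comment> \<open>Arguments of \<open>Groth\<close> are numbered from 1, list positions from
      0.\<close>
    define r where "r = Suc p"
    have r: "1 \<le> r" "r < n" using p' p'_eq by (simp_all add: r_def)
    have "swapj j (L ! (i - 1)) = L ! (swapj r i - 1)" if i: "1 \<le> i" "i \<le> n" for i
    proof -
      consider "i = r" | "i = Suc r" | "i \<noteq> r" "i \<noteq> Suc r" by blast
      then show ?thesis
      proof cases
        case 3
        then have "i - 1 \<noteq> p" "i - 1 \<noteq> p'" using i by (auto simp: r_def p'_eq)
        then have "L ! (i - 1) \<noteq> j" "L ! (i - 1) \<noteq> Suc j"
          using nth_eq_iff_index_eq[OF L(3), of "i - 1" p] nth_eq_iff_index_eq[OF L(3), of "i - 1" p']
            L(1) p p' i by auto
        then show ?thesis using 3 by (simp add: swapj_def)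
      qed (use p p' p'_eq in \<open>simp_all add: swapj_def r_def\<close>)
    qed
    then have "Groth (fps_const betaK) n lam (\<lambda>r. bethe_root n N mu (swapj j (L' ! (r - 1)))) s =
        Groth (fps_const betaK) n lam (\<lambda>i. x (swapj r i)) s"
      by (intro Groth_cong_vars[OF lam]) (simp add: x_def L')
    also have "\<dots> = Groth (fps_const betaK) n lam x s"
    proof (rule Groth_swap_vars[OF lam r])
      have "fps_nth (x r) 0 = tK N j"
        using is_bethe_root[OF IN] True p by (simp add: x_def r_def is_bethe_root_def I_def)
      then have "fps_nth (1 + fps_const betaK * x r) 0 \<noteq> 0"
        using one_plus_betaK_tK[of N j] by simp
      then show "1 + fps_const betaK * x r \<noteq> 0" by (metis fps_zero_nth)
    qed
    finally show ?thesis .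
  qed
  finally show ?thesis by (simp add: x_def s_def L_def I_def N_def)
qed

theorem mainTheorem2:
  fixes n k N j :: nat and lam mu :: "nat \<Rightarrow> nat"
  assumes "N = n + k"
    and "part_box n k lam" and "part_box n k mu"
    and "1 \<le> j" and "j \<le> N - 1"
  shows "sigmaF j (G_at n N lam (sj_part n j mu)) - G_at n N lam mu =
    (if j \<notin> Iset n lam \<and> Suc j \<in> Iset n lam
     then fps_const (ominusB betaK (tK N j) (tK N (Suc j)))
            * (fps_const betaK * G_at n N lam mu + G_at n N (sj_part n j lam) mu)
     else 0)"
proof -
  have j: "1 \<le> j" "j < n + k" using assms(1,4,5) by simp_all
  define s where "s = (\<lambda>m. fps_const (uminusB betaK (tK N m)))"
  define x where "x = (\<lambda>r. bethe_root n N mu (sorted_list_of_set (Iset n mu) ! (r - 1)))"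
  have G: "G_at n N nu mu = Groth (fps_const betaK) n nu x s" for nu
    by (simp add: G_at_def x_def s_def)
  have sG: "sigmaF j (G_at n N lam (sj_part n j mu)) = Groth (fps_const betaK) n lam x (\<lambda>m. s (swapj j m))"
    using sigmaF_G_at[OF assms(2,3) j] by (simp add: assms(1) x_def s_def)
  note swap = Groth_swap_params[OF assms(2) j, where b = "fps_const betaK" and x = x and s = s]
  show ?thesis
  proof (cases "j \<notin> Iset n lam \<and> Suc j \<in> Iset n lam")
    case False
    then show ?thesis unfolding G sG if_not_P[OF False] swap(1)[OF False] by simp
  next
    case True
    define t t' where "t = tK N j" and "t' = tK N (Suc j)"
    have nz: "1 + betaK * t \<noteq> 0" "1 + betaK * t' \<noteq> 0" by (simp_all add: t_def t'_def one_plus_betaK_tK)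
    have unit: "1 + betaK * uminusB betaK t = inverse (1 + betaK * t)"
      using nz by (simp add: uminusB_def field_simps)
    have diff: "uminusB betaK t' - uminusB betaK t = (1 + betaK * uminusB betaK t) * ominusB betaK t t'"
      unfolding unit using nz by (simp add: uminusB_def ominusB_def field_simps)
    have unit': "1 + fps_const betaK * s j = fps_const (inverse (1 + betaK * t))"
      unfolding unit[symmetric] by (simp add: s_def t_def flip: fps_const_add)
    have diff': "s (Suc j) - s j = fps_const (inverse (1 + betaK * t)) * fps_const (ominusB betaK t t')"
      using diff unfolding unit by (simp add: s_def t_def t'_def)
    \<comment> \<open>This factor comes on the left from the coefficient 1 + beta s_j and on the
      right from the difference of parameters; being nonzero, it cancels in the domain of power
      series.\<close>
    have "fps_const (inverse (1 + betaK * t)) \<noteq> 0" using nz by simp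
    moreover have "fps_const (inverse (1 + betaK * t)) * (sigmaF j (G_at n N lam (sj_part n j mu)) - G_at n N lam mu) =
        fps_const (inverse (1 + betaK * t)) * (fps_const (ominusB betaK t t')
          * (fps_const betaK * G_at n N lam mu + G_at n N (sj_part n j lam) mu))"
      using swap(2)[OF conjunct1[OF True] conjunct2[OF True]] unfolding G sG unit' diff'
      by (simp only: mult.assoc)
    ultimately show ?thesis
      unfolding if_P[OF True] t_def[symmetric] t'_def[symmetric] by (metis mult_cancel_left)
  qed
qed

end
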